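(* Let $m\ge 1$, $\varepsilon(1),\ldots,\varepsilon(m)\in\{-1,1\}$ and $f_1,\ldots,f_m\in\mathcal{R}^\infty([0,1])$. Then the limit $$\lim_{N\to\infty}\omega_\Omega\big(S_N^{\varepsilon(1)}(a,f_1)\cdots S_N^{\varepsilon(m)}(a,f_m)\big)$$ exists. It vanishes if $m$ is odd, and for $m=2n$ it is equal to $$\omega_\Omega\big(a^{\varepsilon(1)}(f_1)\cdots a^{\varepsilon(2n)}(f_{2n})\big).$$ Here $\omega_\Omega$ in the first display is the vacuum state on the discrete monotone Fock space, and $\omega_\Omega$ in the second display is the vacuum state on the continuous monotone Fock space over $[0,1]$.
   Context: $\mathcal{R}^\infty([0,1])$ denotes the set of bounded complex-valued Riemann integrable functions on $[0,1]$. Discrete monotone Fock space. For $k\ge 1$ let $I_k$ be the set of strictly increasing sequences $(i_1<i_2<\cdots<i_k)$ of natural numbers, and $I_0=\{\emptyset\}$. The discrete monotone Fock space is $\mathcal{F}_m=\bigoplus_{k=0}^\infty \ell^2(I_k)$, with canonical orthonormal basis $e_\alpha$, $\alpha\in\bigcup_k I_k$, and vacuum $\Omega=e_\emptyset$. For $i\in\mathbb{N}$ the monotone creation operator is the bounded operator with $a_i^\dagger e_{(i_1,\ldots,i_k)}=e_{(i,i_1,\ldots,i_k)}$ if $i<i_1$ (or if $k=0$) and $0$ otherwise; the monotone annihilation operator $a_i$ is its adjoint: $a_i e_{(i_1,\ldots,i_k)}=e_{(i_2,\ldots,i_k)}$ if $k\ge1$ and $i=i_1$, and $0$ otherwise.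 Write $a_i^{1}=a_i^\dagger$, $a_i^{-1}=a_i$. For $f\in\mathcal{R}^\infty([0,1])$ and $N\ge 1$ set $$S_N^{1}(a,f)=\frac1{\sqrt N}\sum_{k=1}^N f\Big(\frac kN\Big)a_k^\dagger,\qquad S_N^{-1}(a,f)=\frac1{\sqrt N}\sum_{k=1}^N \overline{f\Big(\frac kN\Big)}\,a_k .$$ Continuous monotone Fock space over $J=[0,1]$. For $n\ge 1$ let $J^n_+=\{(t_1,\ldots,t_n)\in[0,1]^n: t_1<\cdots<t_n\}$ and $\mathfrak{h}_n=L^2(J^n_+)$ with respect to Lebesgue measure, and $\mathfrak{h}_0=\mathbb{C}\Omega$, with $\Omega$ a unit vector (the vacuum). Set $\Gamma_M=\bigoplus_{n\ge0}\mathfrak{h}_n$ (Hilbert space direct sum; inner products are linear in the second variable). For $f\in L^2([0,1])$, the creation operator $a^\dagger(f)$ is the bounded operator mapping $\mathfrak{h}_n$ to $\mathfrak{h}_{n+1}$ by $[a^\dagger(f)g](t,t_1,\ldots,t_n)=f(t)g(t_1,\ldots,t_n)$ on $t<t_1<\cdots<t_n$ (and $a^\dagger(f)\Omega=f$); the annihilation operator $a(f)$ is its adjoint, so $a(f)\Omega=0$, $a(f)g=\big(\int_0^1\overline{f(t)}g(t)\,dt\big)\Omega$ for $g\in\mathfrak{h}_1$, and $[a(f)g](t_1,\ldots,t_n)=\int_{t<t_1}\overline{f(t)}g(t,t_1,\ldots,t_n)\,dt$ for $g\in\mathfrak{h}_{n+1}$, $n\ge1$. Write $a^1(f)=a^\dagger(f)$,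 $a^{-1}(f)=a(f)$. In either Fock space, $\omega_\Omega(X)=\langle\Omega,X\Omega\rangle$ is the vacuum state. *)

theory Defs
  imports "HOL-Analysis.Analysis"
begin

section \<open>Bounded Riemann integrable functions\<close>

(* The gauge integral of the library also integrates functions such as the indicator of the
   rationals, so Riemann integrability (convergence of tagged Riemann sums as the mesh tends
   to 0) is defined separately. *)
definition riemann_integrable_on :: "(real \<Rightarrow> 'b::real_normed_vector) \<Rightarrow> real \<Rightarrow> real \<Rightarrow> bool" where
  "riemann_integrable_on f a b \<longleftrightarrow>
     (\<exists>I. \<forall>e>0. \<exists>d>0. \<forall>p. p tagged_division_of {a..b} \<and> (\<forall>(x, K)\<in>p. diameter K < d) \<longrightarrow>
        norm ((\<Sum>(x, K)\<in>p. measure lborel K *\<^sub>R f x) - I) < e)"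

(* Membership depends only on the restriction of f to [0,1]. *)
definition Rinf :: "(real \<Rightarrow> complex) set" where
  "Rinf = {f. bounded (f ` {0..1}) \<and> riemann_integrable_on f 0 1}"

section \<open>Discrete monotone Fock space\<close>

definition incr_seqs :: "nat list set" where
  "incr_seqs = {\<alpha>. sorted_wrt (<) \<alpha>}"

(* The direct sum over k of l2(I_k) is l2 of the disjoint union of the I_k; its elements are
   the square-summable functions on all lists that vanish off the increasing ones. *)
type_synonym disc_vec = "nat list \<Rightarrow> complex"

definition disc_fock :: "disc_vec set" where
  "disc_fock = {x. (\<forall>\<alpha>. \<alpha> \<notin> incr_seqs \<longrightarrow> x \<alpha> = 0) \<and>
                   (\<lambda>\<alpha>. (cmod (x \<alpha>))\<^sup>2) summable_on incr_seqs}"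

definition disc_inner :: "disc_vec \<Rightarrow> disc_vec \<Rightarrow> complex" where
  "disc_inner x y = (\<Sum>\<^sub>\<infinity>\<alpha>\<in>incr_seqs. cnj (x \<alpha>) * y \<alpha>)"

definition disc_basis :: "nat list \<Rightarrow> disc_vec" where
  "disc_basis \<alpha> = (\<lambda>\<beta>. if \<beta> = \<alpha> then 1 else 0)"

definition disc_vacuum :: disc_vec where
  "disc_vacuum = disc_basis []"

(* Coefficient form of the operators; see disc_create_basis and disc_annihilate_basis for the
   action on the orthonormal basis and disc_adjoint for the adjoint relation. *)
definition disc_create :: "nat \<Rightarrow> disc_vec \<Rightarrow> disc_vec" where
  "disc_create i x = (\<lambda>\<beta>. if \<beta> \<in> incr_seqs \<and> \<beta> \<noteq> [] \<and> hd \<beta> = i then x (tl \<beta>) else 0)"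

definition disc_annihilate :: "nat \<Rightarrow> disc_vec \<Rightarrow> disc_vec" where
  "disc_annihilate i x = (\<lambda>\<beta>. if i # \<beta> \<in> incr_seqs then x (i # \<beta>) else 0)"

(* The sign e is meant to be 1 (creation) or -1 (annihilation). *)
definition disc_S :: "int \<Rightarrow> nat \<Rightarrow> (real \<Rightarrow> complex) \<Rightarrow> disc_vec \<Rightarrow> disc_vec" where
  "disc_S e N f x = (\<lambda>\<beta>. complex_of_real (1 / sqrt (real N)) *
     (\<Sum>k=1..N. if e = 1 then f (real k / real N) * disc_create k x \<beta>
                else cnj (f (real k / real N)) * disc_annihilate k x \<beta>))"

definition disc_state :: "(disc_vec \<Rightarrow> disc_vec) \<Rightarrow> complex" where
  "disc_state X = disc_inner disc_vacuum (X disc_vacuum)"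

section \<open>Continuous monotone Fock space over the unit interval\<close>

definition incr_simplex :: "nat \<Rightarrow> (nat \<Rightarrow> real) set" where
  "incr_simplex n = {t \<in> {..<n} \<rightarrow>\<^sub>E {0..1}. \<forall>i j. i < j \<and> j < n \<longrightarrow> t i < t j}"

(* Lebesgue measure on the increasing simplex, with coordinates indexed by 0,...,n-1. The
   factors carry the Lebesgue sigma-algebra, because Riemann integrable functions need not be
   Borel; not completing the product leaves L2 unchanged. For n = 0 this is a point mass, so
   that its L2 space is the one-dimensional vacuum space. *)
definition simplex_measure :: "nat \<Rightarrow> (nat \<Rightarrow> real) measure" where
  "simplex_measure n = restrict_space (Pi\<^sub>M {..<n} (\<lambda>_. lebesgue_on {0..1})) (incr_simplex n)"

definition L2 :: "'a measure \<Rightarrow> ('a \<Rightarrow> complex) set" where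
  "L2 M = {g \<in> borel_measurable M. integrable M (\<lambda>x. (cmod (g x))\<^sup>2)}"

(* Vectors are represented by functions; g and h denote the same vector iff cont_eq g h. *)
type_synonym cont_vec = "nat \<Rightarrow> (nat \<Rightarrow> real) \<Rightarrow> complex"

definition cont_fock :: "cont_vec set" where
  "cont_fock = {g. (\<forall>n. g n \<in> L2 (simplex_measure n)) \<and>
                   summable (\<lambda>n. LINT t|simplex_measure n. (cmod (g n t))\<^sup>2)}"

definition cont_eq :: "cont_vec \<Rightarrow> cont_vec \<Rightarrow> bool" where
  "cont_eq g h \<longleftrightarrow> (\<forall>n. AE t in simplex_measure n. g n t = h n t)"

definition cont_inner :: "cont_vec \<Rightarrow> cont_vec \<Rightarrow> complex" where
  "cont_inner g h = (\<Sum>n. LINT t|simplex_measure n. cnj (g n t) * h n t)"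

definition cont_vacuum :: cont_vec where
  "cont_vacuum = (\<lambda>n t. if n = 0 then 1 else 0)"

definition cont_create :: "(real \<Rightarrow> complex) \<Rightarrow> cont_vec \<Rightarrow> cont_vec" where
  "cont_create f g = (\<lambda>n t. case n of 0 \<Rightarrow> 0 | Suc k \<Rightarrow> f (t 0) * g k (\<lambda>i. t (Suc i)))"

(* case_nat s t is the tuple (s, t_1, ..., t_n); for n = 0 there is no constraint on s. *)
definition cont_annihilate :: "(real \<Rightarrow> complex) \<Rightarrow> cont_vec \<Rightarrow> cont_vec" where
  "cont_annihilate f g = (\<lambda>n t. LINT s:{s. 0 < n \<longrightarrow> s < t 0}|lebesgue_on {0..1}.
     cnj (f s) * g (Suc n) (case_nat s t))"

(* The operators respect cont_eq, map cont_fock to itself, and are adjoint to each other; see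
   cont_create_cong, cont_annihilate_cong, cont_create_fock, cont_annihilate_fock and
   cont_adjoint below. *)
definition cont_op :: "int \<Rightarrow> (real \<Rightarrow> complex) \<Rightarrow> cont_vec \<Rightarrow> cont_vec" where
  "cont_op e f = (if e = 1 then cont_create f else cont_annihilate f)"

definition cont_state :: "(cont_vec \<Rightarrow> cont_vec) \<Rightarrow> complex" where
  "cont_state X = cont_inner cont_vacuum (X cont_vacuum)"

definition op_prod :: "('v \<Rightarrow> 'v) list \<Rightarrow> 'v \<Rightarrow> 'v" where
  "op_prod Xs = foldr (\<circ>) Xs id"

section \<open>Consistency of the definitions\<close>

lemma Rinf_L2:
  assumes "f \<in> Rinf"
  shows "f \<in> L2 (lebesgue_on {0..1})"
proof -
  from assms have b: "bounded (f ` {0..1})"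
    and r: "\<exists>I. \<forall>e>0. \<exists>d>0. \<forall>p. p tagged_division_of {0..1} \<and> (\<forall>(x, K)\<in>p. diameter K < d) \<longrightarrow>
        norm ((\<Sum>(x, K)\<in>p. measure lborel K *\<^sub>R f x) - I) < e"
    by (auto simp: Rinf_def riemann_integrable_on_def)
  from r obtain I where I: "\<And>e. e > 0 \<Longrightarrow> \<exists>d>0. \<forall>p. p tagged_division_of {0..1} \<and> (\<forall>(x, K)\<in>p. diameter K < d) \<longrightarrow>
        norm ((\<Sum>(x, K)\<in>p. measure lborel K *\<^sub>R f x) - I) < e" by blast
  have "(f has_integral I) (cbox 0 1)"
    unfolding has_integral
  proof (intro allI impI)
    fix e :: real assume "e > 0"
    from I[OF this] obtain d where d: "d > 0"
      "\<And>p. p tagged_division_of {0..1} \<Longrightarrow> (\<forall>(x, K)\<in>p. diameter K < d) \<Longrightarrow>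
        norm ((\<Sum>(x, K)\<in>p. measure lborel K *\<^sub>R f x) - I) < e" by blast
    show "\<exists>\<gamma>. gauge \<gamma> \<and> (\<forall>\<D>. \<D> tagged_division_of cbox 0 1 \<and> \<gamma> fine \<D> \<longrightarrow>
       norm ((\<Sum>(x, k)\<in>\<D>. measure lborel k *\<^sub>R f x) - I) < e)"
    proof (intro exI[of _ "\<lambda>x. ball x (d/3)"] conjI allI impI)
      show "gauge (\<lambda>x::real. ball x (d/3))" using d by (auto intro!: gauge_ball)
    next
      fix p assume p: "p tagged_division_of cbox 0 (1::real) \<and> (\<lambda>x. ball x (d/3)) fine p"
      have "diameter K < d" if "(x, K) \<in> p" for x K
      proof -
        from p that have "K \<subseteq> ball x (d/3)" by (auto simp: fine_def)
        then have "diameter K \<le> diameter (ball x (d/3))"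
          by (intro diameter_subset) auto
        also have "\<dots> < d" using d by simp
        finally show ?thesis .
      qed
      then show "norm ((\<Sum>(x, K)\<in>p. measure lborel K *\<^sub>R f x) - I) < e"
        using p by (intro d) auto
    qed
  qed
  then have "f integrable_on {0..1}" by auto
  then have m: "f \<in> borel_measurable (lebesgue_on {0..1})"
    by (rule integrable_imp_measurable)
  from b obtain B where B: "\<And>x. x \<in> {0..1} \<Longrightarrow> cmod (f x) \<le> B"
    unfolding bounded_iff by blast
  interpret finite_measure "lebesgue_on {0..1::real}"
    by (rule finite_measure_lebesgue_on) simp
  have "integrable (lebesgue_on {0..1}) (\<lambda>x. (cmod (f x))\<^sup>2)"
  proof (rule integrable_const_bound[where B="B\<^sup>2"])
    show "AE x in lebesgue_on {0..1}. norm ((cmod (f x))\<^sup>2) \<le> B\<^sup>2"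
      using B by (auto intro!: AE_I2 power_mono)
    show "(\<lambda>x. (cmod (f x))\<^sup>2) \<in> borel_measurable (lebesgue_on {0..1})"
      using m by measurable
  qed
  with m show ?thesis by (simp add: L2_def)
qed

lemma disc_create_basis:
  assumes "\<alpha> \<in> incr_seqs"
  shows "disc_create i (disc_basis \<alpha>) =
    (if \<alpha> = [] \<or> i < hd \<alpha> then disc_basis (i # \<alpha>) else (\<lambda>_. 0))"
proof -
  have *: "i # \<alpha> \<in> incr_seqs \<longleftrightarrow> \<alpha> = [] \<or> i < hd \<alpha>"
    using assms by (cases \<alpha>) (auto simp: incr_seqs_def)
  show ?thesis
    unfolding *[symmetric]
  proof (rule ext)
    fix \<beta>
    show "disc_create i (disc_basis \<alpha>) \<beta> =
        (if i # \<alpha> \<in> incr_seqs then disc_basis (i # \<alpha>) else (\<lambda>_. 0)) \<beta>"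
      by (cases \<beta>) (auto simp: disc_create_def disc_basis_def)
  qed
qed

lemma disc_annihilate_basis:
  assumes "\<alpha> \<in> incr_seqs"
  shows "disc_annihilate i (disc_basis \<alpha>) =
    (if \<alpha> \<noteq> [] \<and> i = hd \<alpha> then disc_basis (tl \<alpha>) else (\<lambda>_. 0))"
  using assms by (cases \<alpha>) (auto simp: disc_annihilate_def disc_basis_def incr_seqs_def fun_eq_iff)

lemma tl_incr: "\<beta> \<in> incr_seqs \<Longrightarrow> tl \<beta> \<in> incr_seqs"
  by (cases \<beta>) (auto simp: incr_seqs_def)

lemma bij_cons:
  "bij_betw (Cons i) {\<beta>. i # \<beta> \<in> incr_seqs} {\<beta> \<in> incr_seqs. \<beta> \<noteq> [] \<and> hd \<beta> = i}"
  by (rule bij_betwI[where g=tl]) auto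

lemma disc_create_fock:
  assumes "x \<in> disc_fock"
  shows "disc_create i x \<in> disc_fock"
proof -
  let ?A = "{\<beta>. i # \<beta> \<in> incr_seqs}"
  have "?A \<subseteq> incr_seqs" by (auto simp: incr_seqs_def)
  with assms have "(\<lambda>\<beta>. (cmod (x \<beta>))\<^sup>2) summable_on ?A"
    unfolding disc_fock_def by (auto intro: summable_on_subset_banach)
  then have "(\<lambda>\<beta>. (cmod (x (tl (i # \<beta>))))\<^sup>2) summable_on ?A" by simp
  then have "(\<lambda>\<beta>. (cmod (x (tl \<beta>)))\<^sup>2) summable_on {\<beta> \<in> incr_seqs. \<beta> \<noteq> [] \<and> hd \<beta> = i}"
    by (subst (asm) summable_on_reindex_bij_betw[OF bij_cons])
  then have "(\<lambda>\<beta>. (cmod (disc_create i x \<beta>))\<^sup>2) summable_on incr_seqs"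
    by (rule summable_on_cong_neutral[THEN iffD1, rotated -1]) (auto simp: disc_create_def)
  then show ?thesis by (auto simp: disc_fock_def disc_create_def)
qed

lemma disc_annihilate_fock:
  assumes "x \<in> disc_fock"
  shows "disc_annihilate i x \<in> disc_fock"
proof -
  let ?A = "{\<beta>. i # \<beta> \<in> incr_seqs}"
  have "(\<lambda>\<beta>. (cmod (x \<beta>))\<^sup>2) summable_on {\<beta> \<in> incr_seqs. \<beta> \<noteq> [] \<and> hd \<beta> = i}"
    using assms unfolding disc_fock_def by (auto intro: summable_on_subset_banach)
  then have "(\<lambda>\<beta>. (cmod (x (i # \<beta>)))\<^sup>2) summable_on ?A"
    by (subst summable_on_reindex_bij_betw[OF bij_cons])
  then have "(\<lambda>\<beta>. (cmod (disc_annihilate i x \<beta>))\<^sup>2) summable_on incr_seqs"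
    by (rule summable_on_cong_neutral[THEN iffD1, rotated -1])
       (auto simp: disc_annihilate_def incr_seqs_def)
  then show ?thesis by (auto simp: disc_fock_def disc_annihilate_def incr_seqs_def)
qed

lemma disc_adjoint: "disc_inner x (disc_create i y) = disc_inner (disc_annihilate i x) y"
proof -
  have "disc_inner x (disc_create i y) =
      (\<Sum>\<^sub>\<infinity>\<beta>\<in>{\<beta> \<in> incr_seqs. \<beta> \<noteq> [] \<and> hd \<beta> = i}. cnj (x \<beta>) * y (tl \<beta>))"
    unfolding disc_inner_def by (rule infsum_cong_neutral) (auto simp: disc_create_def)
  also have "\<dots> = (\<Sum>\<^sub>\<infinity>\<beta>\<in>{\<beta>. i # \<beta> \<in> incr_seqs}. cnj (x (i # \<beta>)) * y (tl (i # \<beta>)))"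
    by (rule infsum_reindex_bij_betw[OF bij_cons, symmetric])
  also have "\<dots> = disc_inner (disc_annihilate i x) y"
    unfolding disc_inner_def
    by (rule infsum_cong_neutral) (auto simp: disc_annihilate_def incr_seqs_def)
  finally show ?thesis .
qed

abbreviation cube :: "nat \<Rightarrow> (nat \<Rightarrow> real) measure" where
  "cube n \<equiv> Pi\<^sub>M {..<n} (\<lambda>_. lebesgue_on {0..1})"

lemma sigma_finite_unit: "sigma_finite_measure (lebesgue_on {0..1::real})"
proof -
  interpret finite_measure "lebesgue_on {0..1::real}"
    by (rule finite_measure_lebesgue_on) simp
  show ?thesis by unfold_locales
qed

lemma sigma_finite_cube: "sigma_finite_measure (cube n)"
proof -
  interpret finite_product_sigma_finite "\<lambda>_. lebesgue_on {0..1::real}" "{..<n}"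
    by (simp add: finite_product_sigma_finite_def finite_product_sigma_finite_axioms_def
        product_sigma_finite_def sigma_finite_unit)
  show ?thesis by unfold_locales
qed

lemma measurable_unit_borel: "(\<lambda>x. x) \<in> borel_measurable (lebesgue_on {0..1::real})"
  by (rule borel_measurable_continuous_on_indicator | rule continuous_imp_measurable_on_sets_lebesgue) (auto intro: continuous_intros)

lemma cube_component: "i < n \<Longrightarrow> (\<lambda>t. t i) \<in> cube n \<rightarrow>\<^sub>M lebesgue_on {0..1}"
  by (rule measurable_component_singleton) simp

lemma incr_simplex_sets: "incr_simplex n \<in> sets (cube n)"
proof -
  have "incr_simplex n = {t \<in> space (cube n). \<forall>j\<in>{..<n}. \<forall>i\<in>{..<j}. t i < t j}"
    by (auto simp: incr_simplex_def space_PiM)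
  also have "\<dots> \<in> sets (cube n)"
    by (auto intro!: borel_measurable_less measurable_compose[OF cube_component measurable_unit_borel]
        sets.sets_Collect_finite_All)
  finally show ?thesis .
qed

lemma incr_simplex_space [simp]: "incr_simplex n \<inter> space (cube n) = incr_simplex n"
  by (auto simp: incr_simplex_def space_PiM)

lemma space_simplex_measure: "space (simplex_measure n) = incr_simplex n"
  by (simp add: simplex_measure_def space_restrict_space)

lemma case_nat_extensional:
  "case_nat s t \<in> extensional {..<Suc n} \<longleftrightarrow> t \<in> extensional {..<n}"
proof
  assume *: "case_nat s t \<in> extensional {..<Suc n}"
  have "t i = undefined" if "\<not> i < n" for i
    using extensional_arb[OF *, of "Suc i"] that by simp
  then show "t \<in> extensional {..<n}" by (auto simp: extensional_def)
qed (auto simp: extensional_def split: nat.splits)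

lemma case_nat_measurable:
  "(\<lambda>(t, s). case_nat s t) \<in> cube n \<Otimes>\<^sub>M lebesgue_on {0..1} \<rightarrow>\<^sub>M cube (Suc n)"
proof -
  have "(\<lambda>p i. case i of 0 \<Rightarrow> snd p | Suc j \<Rightarrow> fst p j) \<in> cube n \<Otimes>\<^sub>M lebesgue_on {0..1} \<rightarrow>\<^sub>M cube (Suc n)"
  proof (rule measurable_PiM_single')
    fix i assume "i \<in> {..<Suc n}"
    then show "(\<lambda>p. case i of 0 \<Rightarrow> snd p | Suc j \<Rightarrow> fst p j)
        \<in> cube n \<Otimes>\<^sub>M lebesgue_on {0..1} \<rightarrow>\<^sub>M lebesgue_on {0..1::real}"
      by (cases i) (auto intro: measurable_compose[OF measurable_fst cube_component])
  next
    show "(\<lambda>p i. case i of 0 \<Rightarrow> snd p | Suc j \<Rightarrow> fst p j)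
        \<in> space (cube n \<Otimes>\<^sub>M lebesgue_on {0..1}) \<rightarrow> (\<Pi>\<^sub>E i\<in>{..<Suc n}. space (lebesgue_on {0..1}))"
    proof
      fix p :: "(nat \<Rightarrow> real) \<times> real"
      assume p: "p \<in> space (cube n \<Otimes>\<^sub>M lebesgue_on {0..1})"
      from p have pf: "fst p \<in> {..<n} \<rightarrow>\<^sub>E {0..1}" and ps: "snd p \<in> {0..1}"
        unfolding space_pair_measure space_PiM space_lebesgue_on mem_Times_iff by blast+
      have "(case i of 0 \<Rightarrow> snd p | Suc j \<Rightarrow> fst p j) \<in> {0..1}" if "i < Suc n" for i
        using PiE_mem[OF pf] ps that by (cases i) simp_all
      moreover have "(\<lambda>i. case i of 0 \<Rightarrow> snd p | Suc j \<Rightarrow> fst p j) \<in> extensional {..<Suc n}"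
        using pf unfolding case_nat_extensional PiE_iff by blast
      ultimately show "(\<lambda>i. case i of 0 \<Rightarrow> snd p | Suc j \<Rightarrow> fst p j)
          \<in> (\<Pi>\<^sub>E i\<in>{..<Suc n}. space (lebesgue_on {0..1}))"
        by (simp add: PiE_iff)
    qed
  qed
  then show ?thesis by (simp add: case_prod_unfold)
qed

lemma tail_measurable: "(\<lambda>t i. t (Suc i)) \<in> cube (Suc n) \<rightarrow>\<^sub>M cube n"
  by (rule measurable_PiM_single')
     (auto intro: cube_component simp: space_PiM PiE_def extensional_def)

lemma distr_case_nat:
  "distr (cube n \<Otimes>\<^sub>M lebesgue_on {0..1}) (cube (Suc n)) (\<lambda>(t, s). case_nat s t) = cube (Suc n)"
proof -
  interpret I: finite_product_sigma_finite "\<lambda>_. lebesgue_on {0..1::real}" "{..<n}"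
    by (simp add: finite_product_sigma_finite_def finite_product_sigma_finite_axioms_def
        product_sigma_finite_def sigma_finite_unit)
  interpret U: sigma_finite_measure "lebesgue_on {0..1::real}" by (rule sigma_finite_unit)
  show ?thesis
  proof (rule I.PiM_eqI)
    fix A :: "nat \<Rightarrow> real set"
    assume A: "\<And>i. i \<in> {..<Suc n} \<Longrightarrow> A i \<in> sets (lebesgue_on {0..1})"
    have sub: "A i \<subseteq> {0..1}" if "i < Suc n" for i
      using sets.sets_into_space[OF A] that by auto
    have "(\<lambda>(t, s). case_nat s t) -` Pi\<^sub>E {..<Suc n} A \<inter> space (cube n \<Otimes>\<^sub>M lebesgue_on {0..1})
        = Pi\<^sub>E {..<n} (\<lambda>i. A (Suc i)) \<times> A 0" (is "?L = ?R")
    proof (intro set_eqI, clarify)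
      fix t :: "nat \<Rightarrow> real" and s
      have "(\<forall>i<Suc n. (case i of 0 \<Rightarrow> s | Suc j \<Rightarrow> t j) \<in> A i) \<longleftrightarrow> s \<in> A 0 \<and> (\<forall>i<n. t i \<in> A (Suc i))"
        by (auto simp: less_Suc_eq_0_disj)
      moreover have "case_nat s t \<in> extensional {..<Suc n} \<longleftrightarrow> t \<in> extensional {..<n}"
        by (rule case_nat_extensional)
      moreover have "\<And>i. i < n \<Longrightarrow> t i \<in> A (Suc i) \<Longrightarrow> t i \<in> {0..1}" "s \<in> A 0 \<Longrightarrow> s \<in> {0..1}"
        using sub by blast+
      ultimately show "(t, s) \<in> ?L \<longleftrightarrow> (t, s) \<in> ?R"
        by (auto simp: space_pair_measure space_PiM PiE_iff)
    qed
    then show "emeasure (distr (cube n \<Otimes>\<^sub>M lebesgue_on {0..1}) (cube (Suc n)) (\<lambda>(t, s). case_nat s t)) (Pi\<^sub>E {..<Suc n} A)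
        = (\<Prod>i\<in>{..<Suc n}. emeasure (lebesgue_on {0..1}) (A i))"
      using A I.measure_times[of "\<lambda>i. A (Suc i)"] by (subst emeasure_distr[OF case_nat_measurable])
         (auto intro!: sets_PiM_I_finite simp: sigma_finite_measure.emeasure_pair_measure_Times[OF sigma_finite_unit] I.measure_times
            prod.lessThan_Suc_shift mult.commute simp del: prod.lessThan_Suc)
  qed auto
qed

lemma case_nat_incr_simplex:
  assumes "t \<in> space (cube n)" "s \<in> {0..1}"
  shows "case_nat s t \<in> incr_simplex (Suc n) \<longleftrightarrow> t \<in> incr_simplex n \<and> (0 < n \<longrightarrow> s < t 0)"
proof
  assume *: "case_nat s t \<in> incr_simplex (Suc n)"
  have inc: "case_nat s t i < case_nat s t j" if "i < j" "j < Suc n" for i j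
    using * that by (auto simp: incr_simplex_def)
  have "t i < t j" if "i < j" "j < n" for i j using inc[of "Suc i" "Suc j"] that by simp
  moreover have "s < t 0" if "0 < n" using inc[of 0 1] that by simp
  ultimately show "t \<in> incr_simplex n \<and> (0 < n \<longrightarrow> s < t 0)"
    using assms by (auto simp: incr_simplex_def space_PiM)
next
  assume *: "t \<in> incr_simplex n \<and> (0 < n \<longrightarrow> s < t 0)"
  have "s < t j" if "j < n" for j
    using * that by (cases j) (auto simp: incr_simplex_def intro: less_trans)
  then show "case_nat s t \<in> incr_simplex (Suc n)"
    using assms * by (auto simp: incr_simplex_def space_PiM PiE_iff extensional_def split: nat.splits)
qed

lemma tail_incr_simplex: "t \<in> incr_simplex (Suc n) \<Longrightarrow> (\<lambda>i. t (Suc i)) \<in> incr_simplex n"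
  by (auto simp: incr_simplex_def PiE_iff extensional_def)


lemma measurable_simplex_pair:
  fixes u :: "(nat \<Rightarrow> real) \<Rightarrow> 'b::{banach, second_countable_topology}"
  assumes "u \<in> borel_measurable (simplex_measure (Suc n))"
  shows "(\<lambda>(t, s). indicator (incr_simplex (Suc n)) (case_nat s t) *\<^sub>R u (case_nat s t))
    \<in> borel_measurable (cube n \<Otimes>\<^sub>M lebesgue_on {0..1})"
proof -
  have "(\<lambda>t. indicator (incr_simplex (Suc n)) t *\<^sub>R u t) \<in> borel_measurable (cube (Suc n))"
    using assms by (simp add: simplex_measure_def borel_measurable_restrict_space_iff incr_simplex_sets)
  from measurable_compose[OF case_nat_measurable this] show ?thesis
    by (simp add: case_prod_unfold)
qed

lemma indicator_case_nat:
  assumes "t \<in> space (cube n)" "s \<in> {0..1}"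
  shows "indicator (incr_simplex (Suc n)) (case_nat s t) =
    (indicator (incr_simplex n) t * indicator {s. 0 < n \<longrightarrow> s < t 0} s :: 'b::semiring_1)"
  using case_nat_incr_simplex[OF assms] by (auto simp: indicator_def)

lemma slice_ennreal:
  fixes u :: "(nat \<Rightarrow> real) \<Rightarrow> ennreal"
  assumes "t \<in> space (cube n)" "s \<in> space (lebesgue_on {0..1})"
  shows "u (case_nat s t) * indicator (incr_simplex (Suc n)) (case_nat s t) =
    (indicator {s. 0 < n \<longrightarrow> s < t 0} s * u (case_nat s t)) * indicator (incr_simplex n) t"
  using indicator_case_nat[OF assms(1), of s, where 'b=ennreal] assms(2) by (simp add: mult_ac)

lemma slice_nn_integral:
  assumes "t \<in> space (cube n)"
  shows "(\<integral>\<^sup>+s. u (case_nat s t) * indicator (incr_simplex (Suc n)) (case_nat s t) \<partial>lebesgue_on {0..1}) =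
    (\<integral>\<^sup>+s. indicator {s. 0 < n \<longrightarrow> s < t 0} s * u (case_nat s t) \<partial>lebesgue_on {0..1})
      * indicator (incr_simplex n) t"
proof -
  have "(\<integral>\<^sup>+s. u (case_nat s t) * indicator (incr_simplex (Suc n)) (case_nat s t) \<partial>lebesgue_on {0..1}) =
      (\<integral>\<^sup>+s. (indicator {s. 0 < n \<longrightarrow> s < t 0} s * u (case_nat s t)) * indicator (incr_simplex n) t \<partial>lebesgue_on {0..1})"
    by (rule nn_integral_cong) (rule slice_ennreal[where u=u, OF assms], assumption)
  also have "\<dots> = (\<integral>\<^sup>+s. indicator {s. 0 < n \<longrightarrow> s < t 0} s * u (case_nat s t) \<partial>lebesgue_on {0..1})
      * indicator (incr_simplex n) t"
    by (cases "t \<in> incr_simplex n") simp_all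
  finally show ?thesis .
qed

lemma measurable_simplex_pair_ennreal:
  assumes "u \<in> borel_measurable (simplex_measure (Suc n))"
  shows "(\<lambda>(t, s). u (case_nat s t) * indicator (incr_simplex (Suc n)) (case_nat s t) :: ennreal)
    \<in> borel_measurable (cube n \<Otimes>\<^sub>M lebesgue_on {0..1})"
proof -
  have "(\<lambda>t. u t * indicator (incr_simplex (Suc n)) t) \<in> borel_measurable (cube (Suc n))"
    using assms by (simp add: simplex_measure_def borel_measurable_restrict_space_iff_ennreal incr_simplex_sets)
  from measurable_compose[OF case_nat_measurable this] show ?thesis
    by (simp add: case_prod_unfold)
qed

lemma slice_measurable_ennreal:
  assumes u: "u \<in> borel_measurable (simplex_measure (Suc n))" and t: "t \<in> incr_simplex n"
  shows "(\<lambda>s. indicator {s. 0 < n \<longrightarrow> s < t 0} s * u (case_nat s t) :: ennreal)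
    \<in> borel_measurable (lebesgue_on {0..1})"
proof -
  have tc: "t \<in> space (cube n)" using t incr_simplex_space by blast
  have "(\<lambda>s. u (case_nat s t) * indicator (incr_simplex (Suc n)) (case_nat s t))
    \<in> borel_measurable (lebesgue_on {0..1})"
    using measurable_compose[OF measurable_Pair1'[OF tc] measurable_simplex_pair_ennreal[OF u]] by simp
  moreover have "u (case_nat s t) * indicator (incr_simplex (Suc n)) (case_nat s t) =
      indicator {s. 0 < n \<longrightarrow> s < t 0} s * u (case_nat s t)" if "s \<in> space (lebesgue_on {0..1})" for s
    using slice_ennreal[OF tc that, of u] t by simp
  ultimately show ?thesis by (subst measurable_cong[symmetric]) auto
qed

lemma slice_nn_integral_measurable:
  assumes u: "u \<in> borel_measurable (simplex_measure (Suc n))"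
  shows "(\<lambda>t. \<integral>\<^sup>+s. indicator {s. 0 < n \<longrightarrow> s < t 0} s * u (case_nat s t) \<partial>lebesgue_on {0..1})
    \<in> borel_measurable (simplex_measure n)"
proof -
  interpret U: sigma_finite_measure "lebesgue_on {0..1::real}" by (rule sigma_finite_unit)
  let ?L = "\<lambda>t. \<integral>\<^sup>+s. u (case_nat s t) * indicator (incr_simplex (Suc n)) (case_nat s t) \<partial>lebesgue_on {0..1}"
  let ?R = "\<lambda>t. (\<integral>\<^sup>+s. indicator {s. 0 < n \<longrightarrow> s < t 0} s * u (case_nat s t) \<partial>lebesgue_on {0..1})
      * indicator (incr_simplex n) t"
  have "?L \<in> borel_measurable (cube n)"
    using U.borel_measurable_nn_integral_fst[OF measurable_simplex_pair_ennreal[OF u]] by simp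
  also have "?L \<in> borel_measurable (cube n) \<longleftrightarrow> ?R \<in> borel_measurable (cube n)"
    by (rule measurable_cong[of "cube n" ?L ?R]) (simp only: slice_nn_integral)
  finally show ?thesis
    unfolding simplex_measure_def
    by (subst borel_measurable_restrict_space_iff_ennreal) (simp_all only: incr_simplex_space incr_simplex_sets)
qed

lemma nn_integral_simplex_Suc:
  assumes u: "u \<in> borel_measurable (simplex_measure (Suc n))"
  shows "(\<integral>\<^sup>+t. u t \<partial>simplex_measure (Suc n)) =
    (\<integral>\<^sup>+t. \<integral>\<^sup>+s. indicator {s. 0 < n \<longrightarrow> s < t 0} s * u (case_nat s t) \<partial>lebesgue_on {0..1} \<partial>simplex_measure n)"
proof -
  interpret U: sigma_finite_measure "lebesgue_on {0..1::real}" by (rule sigma_finite_unit)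
  let ?v = "\<lambda>t. u t * indicator (incr_simplex (Suc n)) t"
  have v: "?v \<in> borel_measurable (cube (Suc n))"
    using assms by (simp add: simplex_measure_def borel_measurable_restrict_space_iff_ennreal incr_simplex_sets)
  note vp = measurable_compose[OF case_nat_measurable v]
  have "(\<integral>\<^sup>+t. u t \<partial>simplex_measure (Suc n)) = (\<integral>\<^sup>+t. ?v t \<partial>cube (Suc n))"
    by (simp add: simplex_measure_def nn_integral_restrict_space incr_simplex_sets)
  also have "\<dots> = (\<integral>\<^sup>+p. ?v (case p of (t, s) \<Rightarrow> case_nat s t) \<partial>(cube n \<Otimes>\<^sub>M lebesgue_on {0..1}))"
    by (subst distr_case_nat[symmetric]) (rule nn_integral_distr[OF case_nat_measurable], use v in simp)
  also have "\<dots> = (\<integral>\<^sup>+t. \<integral>\<^sup>+s. ?v (case_nat s t) \<partial>lebesgue_on {0..1} \<partial>cube n)"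
    by (subst U.nn_integral_fst[symmetric]) (use vp in auto)
  also have "\<dots> = (\<integral>\<^sup>+t. (\<integral>\<^sup>+s. indicator {s. 0 < n \<longrightarrow> s < t 0} s * u (case_nat s t) \<partial>lebesgue_on {0..1})
      * indicator (incr_simplex n) t \<partial>cube n)"
    by (rule nn_integral_cong, rule slice_nn_integral[where u=u], assumption)
  also have "\<dots> = (\<integral>\<^sup>+t. \<integral>\<^sup>+s. indicator {s. 0 < n \<longrightarrow> s < t 0} s * u (case_nat s t) \<partial>lebesgue_on {0..1} \<partial>simplex_measure n)"
    by (simp add: simplex_measure_def nn_integral_restrict_space incr_simplex_sets)
  finally show ?thesis .
qed

lemma integral_simplex_Suc:
  fixes u :: "(nat \<Rightarrow> real) \<Rightarrow> complex"
  assumes u: "integrable (simplex_measure (Suc n)) u"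
  shows "(LINT t|simplex_measure (Suc n). u t) =
    (LINT t|simplex_measure n. (LINT s:{s. 0 < n \<longrightarrow> s < t 0}|lebesgue_on {0..1}. u (case_nat s t)))"
proof -
  interpret U: sigma_finite_measure "lebesgue_on {0..1::real}" by (rule sigma_finite_unit)
  interpret C: sigma_finite_measure "cube n" by (rule sigma_finite_cube)
  interpret P: pair_sigma_finite "cube n" "lebesgue_on {0..1::real}" ..
  let ?v = "\<lambda>t. indicator (incr_simplex (Suc n)) t *\<^sub>R u t"
  have v: "integrable (cube (Suc n)) ?v"
    using u by (simp add: simplex_measure_def integrable_restrict_space incr_simplex_sets)
  have vp: "integrable (cube n \<Otimes>\<^sub>M lebesgue_on {0..1}) (\<lambda>p. ?v (case p of (t, s) \<Rightarrow> case_nat s t))"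
    by (rule integrable_distr[OF case_nat_measurable]) (use v in \<open>simp only: distr_case_nat\<close>)
  have "(LINT t|simplex_measure (Suc n). u t) = (LINT t|cube (Suc n). ?v t)"
    by (simp add: simplex_measure_def integral_restrict_space incr_simplex_sets)
  also have "\<dots> = (LINT p|(cube n \<Otimes>\<^sub>M lebesgue_on {0..1}). ?v (case p of (t, s) \<Rightarrow> case_nat s t))"
    by (subst distr_case_nat[symmetric]) (rule integral_distr[OF case_nat_measurable], use v in auto)
  also have "\<dots> = (LINT t|cube n. LINT s|lebesgue_on {0..1}. ?v (case_nat s t))"
    by (subst P.integral_fst'[symmetric]) (use vp in auto)
  also have "\<dots> = (LINT t|cube n. indicator (incr_simplex n) t *\<^sub>R
      (LINT s:{s. 0 < n \<longrightarrow> s < t 0}|lebesgue_on {0..1}. u (case_nat s t)))"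
  proof (intro Bochner_Integration.integral_cong refl)
    fix t assume t: "t \<in> space (cube n)"
    have "(LINT s|lebesgue_on {0..1}. ?v (case_nat s t)) =
      (LINT s|lebesgue_on {0..1}. indicator (incr_simplex n) t *\<^sub>R
         (indicator {s. 0 < n \<longrightarrow> s < t 0} s *\<^sub>R u (case_nat s t)))"
    proof (rule Bochner_Integration.integral_cong[OF refl])
      fix s assume "s \<in> space (lebesgue_on {0..1::real})"
      then have "s \<in> {0..1}" by simp
      from indicator_case_nat[OF t this, where 'b=real] show "?v (case_nat s t) = indicator (incr_simplex n) t *\<^sub>R
         (indicator {s. 0 < n \<longrightarrow> s < t 0} s *\<^sub>R u (case_nat s t))"
        by (simp only: scaleR_scaleR)
    qed
    then show "(LINT s|lebesgue_on {0..1}. ?v (case_nat s t)) = indicator (incr_simplex n) t *\<^sub>R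
      (LINT s:{s. 0 < n \<longrightarrow> s < t 0}|lebesgue_on {0..1}. u (case_nat s t))"
      by (simp add: set_lebesgue_integral_def del: scaleR_scaleR)
  qed
  also have "\<dots> = (LINT t|simplex_measure n. (LINT s:{s. 0 < n \<longrightarrow> s < t 0}|lebesgue_on {0..1}. u (case_nat s t)))"
    by (simp add: simplex_measure_def integral_restrict_space incr_simplex_sets)
  finally show ?thesis .
qed

lemma head_measurable:
  "(\<lambda>t. t 0) \<in> simplex_measure (Suc n) \<rightarrow>\<^sub>M lebesgue_on {0..1}"
  unfolding simplex_measure_def by (intro measurable_restrict_space1 cube_component) simp

lemma tail_measurable_simplex:
  "(\<lambda>t i. t (Suc i)) \<in> simplex_measure (Suc n) \<rightarrow>\<^sub>M simplex_measure n"
  unfolding simplex_measure_def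
  by (rule measurable_restrict_space3[OF tail_measurable]) (auto intro: tail_incr_simplex)

lemma annihilate_measurable:
  assumes f: "f \<in> borel_measurable (lebesgue_on {0..1})"
    and g: "g (Suc n) \<in> borel_measurable (simplex_measure (Suc n))"
  shows "cont_annihilate f g n \<in> borel_measurable (simplex_measure n)"
proof -
  interpret U: sigma_finite_measure "lebesgue_on {0..1::real}" by (rule sigma_finite_unit)
  have "(\<lambda>t. cnj (f (t 0)) * g (Suc n) t) \<in> borel_measurable (simplex_measure (Suc n))"
    by (intro borel_measurable_times g borel_measurable_continuous_on[where f=cnj] continuous_intros
        measurable_compose[OF head_measurable f])
  from measurable_simplex_pair[OF this]
  have "(\<lambda>t. LINT s|lebesgue_on {0..1}. indicator (incr_simplex (Suc n)) (case_nat s t) *\<^sub>R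
      (cnj (f s) * g (Suc n) (case_nat s t))) \<in> borel_measurable (cube n)"
    by (intro U.borel_measurable_lebesgue_integral) (simp add: case_prod_unfold)
  also have "?this \<longleftrightarrow> (\<lambda>t. LINT s|lebesgue_on {0..1}. indicator (incr_simplex n) t *\<^sub>R
      indicator {s. 0 < n \<longrightarrow> s < t 0} s *\<^sub>R (cnj (f s) * g (Suc n) (case_nat s t))) \<in> borel_measurable (cube n)"
    by (intro measurable_cong Bochner_Integration.integral_cong refl)
       (auto simp: indicator_case_nat)
  finally show ?thesis
    by (simp add: simplex_measure_def borel_measurable_restrict_space_iff incr_simplex_sets
        cont_annihilate_def set_lebesgue_integral_def del: scaleR_scaleR)
qed


lemma L2_iff:
  "g \<in> L2 M \<longleftrightarrow> g \<in> borel_measurable M \<and> (\<integral>\<^sup>+x. (ennreal (cmod (g x)))\<^sup>2 \<partial>M) < \<infinity>"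
  unfolding L2_def by (auto simp: integrable_iff_bounded ennreal_power)

lemma L2_nn_integral:
  "g \<in> L2 M \<Longrightarrow> (\<integral>\<^sup>+x. (ennreal (cmod (g x)))\<^sup>2 \<partial>M) = ennreal (LINT x|M. (cmod (g x))\<^sup>2)"
  unfolding L2_def by (subst nn_integral_eq_integral[symmetric]) (auto simp: ennreal_power)

lemma L2_bound:
  assumes "h \<in> borel_measurable N" "f \<in> L2 M" "g \<in> L2 M'"
    and "(\<integral>\<^sup>+x. (ennreal (cmod (h x)))\<^sup>2 \<partial>N) \<le>
      (\<integral>\<^sup>+x. (ennreal (cmod (f x)))\<^sup>2 \<partial>M) * (\<integral>\<^sup>+x. (ennreal (cmod (g x)))\<^sup>2 \<partial>M')"
  shows "h \<in> L2 N \<and> (LINT x|N. (cmod (h x))\<^sup>2) \<le> (LINT x|M. (cmod (f x))\<^sup>2) * (LINT x|M'. (cmod (g x))\<^sup>2)"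
proof -
  have le: "(\<integral>\<^sup>+x. (ennreal (cmod (h x)))\<^sup>2 \<partial>N) \<le>
      ennreal ((LINT x|M. (cmod (f x))\<^sup>2) * (LINT x|M'. (cmod (g x))\<^sup>2))"
    using assms(4) by (simp add: L2_nn_integral assms ennreal_mult)
  then have h: "h \<in> L2 N"
    using assms(1) unfolding L2_iff by (auto intro: le_less_trans)
  from le have "(LINT x|N. (cmod (h x))\<^sup>2) \<le> (LINT x|M. (cmod (f x))\<^sup>2) * (LINT x|M'. (cmod (g x))\<^sup>2)"
    unfolding L2_nn_integral[OF h] by (subst (asm) ennreal_le_iff) auto
  with h show ?thesis by simp
qed

lemma create_measurable:
  assumes "f \<in> borel_measurable (lebesgue_on {0..1})" "g n \<in> borel_measurable (simplex_measure n)"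
  shows "cont_create f g (Suc n) \<in> borel_measurable (simplex_measure (Suc n))"
  unfolding cont_create_def
  by (simp add: borel_measurable_times measurable_compose[OF head_measurable assms(1)]
      measurable_compose[OF tail_measurable_simplex assms(2)])

lemma create_L2:
  assumes f: "f \<in> L2 (lebesgue_on {0..1})" and g: "g n \<in> L2 (simplex_measure n)"
  shows "cont_create f g (Suc n) \<in> L2 (simplex_measure (Suc n)) \<and>
    (LINT t|simplex_measure (Suc n). (cmod (cont_create f g (Suc n) t))\<^sup>2) \<le>
    (LINT s|lebesgue_on {0..1}. (cmod (f s))\<^sup>2) * (LINT t|simplex_measure n. (cmod (g n t))\<^sup>2)"
proof (rule L2_bound[OF _ f g])
  have fm: "f \<in> borel_measurable (lebesgue_on {0..1})" and gm: "g n \<in> borel_measurable (simplex_measure n)"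
    using f g by (auto simp: L2_def)
  show hm: "cont_create f g (Suc n) \<in> borel_measurable (simplex_measure (Suc n))"
    by (rule create_measurable[where g=g, OF fm gm])
  have "(\<integral>\<^sup>+t. (ennreal (cmod (cont_create f g (Suc n) t)))\<^sup>2 \<partial>simplex_measure (Suc n)) =
    (\<integral>\<^sup>+t. \<integral>\<^sup>+s. indicator {s. 0 < n \<longrightarrow> s < t 0} s * (ennreal (cmod (f s * g n t)))\<^sup>2
       \<partial>lebesgue_on {0..1} \<partial>simplex_measure n)"
    using hm by (subst nn_integral_simplex_Suc) (simp_all add: cont_create_def)
  also have "\<dots> \<le> (\<integral>\<^sup>+t. \<integral>\<^sup>+s. (ennreal (cmod (f s)))\<^sup>2 * (ennreal (cmod (g n t)))\<^sup>2
       \<partial>lebesgue_on {0..1} \<partial>simplex_measure n)"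
    by (intro nn_integral_mono) (auto simp: norm_mult ennreal_mult power_mult_distrib split: split_indicator)
  also have "\<dots> = (\<integral>\<^sup>+s. (ennreal (cmod (f s)))\<^sup>2 \<partial>lebesgue_on {0..1}) *
      (\<integral>\<^sup>+t. (ennreal (cmod (g n t)))\<^sup>2 \<partial>simplex_measure n)"
    using fm gm by (simp add: nn_integral_multc nn_integral_cmult)
  finally show "(\<integral>\<^sup>+t. (ennreal (cmod (cont_create f g (Suc n) t)))\<^sup>2 \<partial>simplex_measure (Suc n)) \<le> \<dots>" .
qed

lemma norm_integral_le_nn_integral:
  fixes f :: "'a \<Rightarrow> complex"
  shows "ennreal (cmod (integral\<^sup>L M f)) \<le> (\<integral>\<^sup>+x. ennreal (cmod (f x)) \<partial>M)"
  by (cases "integrable M f") (auto simp: not_integrable_integral_eq intro: integral_norm_bound_ennreal)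

lemma slice_measurable:
  assumes g: "g \<in> borel_measurable (simplex_measure (Suc n))" and t: "t \<in> incr_simplex n"
  shows "(\<lambda>s. indicator {s. 0 < n \<longrightarrow> s < t 0} s *\<^sub>R (g (case_nat s t) :: complex))
    \<in> borel_measurable (lebesgue_on {0..1})"
proof -
  have tc: "t \<in> space (cube n)" using t incr_simplex_space by blast
  have "(\<lambda>s. indicator (incr_simplex (Suc n)) (case_nat s t) *\<^sub>R g (case_nat s t))
    \<in> borel_measurable (lebesgue_on {0..1})"
    using measurable_compose[OF measurable_Pair1'[OF tc] measurable_simplex_pair[OF g]] by simp
  moreover have "indicator (incr_simplex (Suc n)) (case_nat s t) *\<^sub>R g (case_nat s t) =
      indicator {s. 0 < n \<longrightarrow> s < t 0} s *\<^sub>R g (case_nat s t)" if "s \<in> space (lebesgue_on {0..1})" for s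
    using indicator_case_nat[OF tc, of s, where 'b=real] that t by simp
  ultimately show ?thesis by (subst measurable_cong[symmetric]) auto
qed

lemma annihilate_L2:
  assumes f: "f \<in> L2 (lebesgue_on {0..1})" and g: "g (Suc n) \<in> L2 (simplex_measure (Suc n))"
  shows "cont_annihilate f g n \<in> L2 (simplex_measure n) \<and>
    (LINT t|simplex_measure n. (cmod (cont_annihilate f g n t))\<^sup>2) \<le>
    (LINT s|lebesgue_on {0..1}. (cmod (f s))\<^sup>2) * (LINT t|simplex_measure (Suc n). (cmod (g (Suc n) t))\<^sup>2)"
proof (rule L2_bound[OF _ f g])
  have fm: "f \<in> borel_measurable (lebesgue_on {0..1})"
    and gm: "g (Suc n) \<in> borel_measurable (simplex_measure (Suc n))"
    using f g by (auto simp: L2_def)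
  show "cont_annihilate f g n \<in> borel_measurable (simplex_measure n)"
    by (rule annihilate_measurable[where g=g, OF fm gm])
  let ?J = "\<lambda>t s. indicator {s. 0 < n \<longrightarrow> s < t 0} s :: ennreal"
  let ?F = "\<integral>\<^sup>+s. (ennreal (cmod (f s)))\<^sup>2 \<partial>lebesgue_on {0..1}"
  have g2: "(\<lambda>t. (ennreal (cmod (g (Suc n) t)))\<^sup>2) \<in> borel_measurable (simplex_measure (Suc n))"
    using gm by simp
  have "(\<integral>\<^sup>+t. (ennreal (cmod (cont_annihilate f g n t)))\<^sup>2 \<partial>simplex_measure n) \<le>
    (\<integral>\<^sup>+t. ?F * (\<integral>\<^sup>+s. ?J t s * (ennreal (cmod (g (Suc n) (case_nat s t))))\<^sup>2 \<partial>lebesgue_on {0..1}) \<partial>simplex_measure n)"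
  proof (rule nn_integral_mono)
    fix t assume "t \<in> space (simplex_measure n)"
    then have t: "t \<in> incr_simplex n" by (simp add: space_simplex_measure)
    let ?h = "\<lambda>s. indicator {s. 0 < n \<longrightarrow> s < t 0} s *\<^sub>R g (Suc n) (case_nat s t)"
    have "ennreal (cmod (cont_annihilate f g n t)) \<le>
        (\<integral>\<^sup>+s. ennreal (cmod (indicator {s. 0 < n \<longrightarrow> s < t 0} s *\<^sub>R (cnj (f s) * g (Suc n) (case_nat s t)))) \<partial>lebesgue_on {0..1})"
      unfolding cont_annihilate_def set_lebesgue_integral_def by (rule norm_integral_le_nn_integral)
    also have "\<dots> = (\<integral>\<^sup>+s. ennreal (cmod (f s)) * ennreal (cmod (?h s)) \<partial>lebesgue_on {0..1})"
      by (intro nn_integral_cong) (simp add: norm_mult mult_ac ennreal_mult[symmetric])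
    finally have "(ennreal (cmod (cont_annihilate f g n t)))\<^sup>2 \<le>
        (\<integral>\<^sup>+s. ennreal (cmod (f s)) * ennreal (cmod (?h s)) \<partial>lebesgue_on {0..1})\<^sup>2"
      by (intro power_mono) auto
    also have "\<dots> \<le> ?F * (\<integral>\<^sup>+s. (ennreal (cmod (?h s)))\<^sup>2 \<partial>lebesgue_on {0..1})"
      by (intro Cauchy_Schwarz_nn_integral measurable_compose[OF _ measurable_ennreal]
          measurable_compose[OF _ borel_measurable_norm] fm slice_measurable[OF gm t])
    also have "(\<integral>\<^sup>+s. (ennreal (cmod (?h s)))\<^sup>2 \<partial>lebesgue_on {0..1}) =
        (\<integral>\<^sup>+s. ?J t s * (ennreal (cmod (g (Suc n) (case_nat s t))))\<^sup>2 \<partial>lebesgue_on {0..1})"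
      by (intro nn_integral_cong) (simp split: split_indicator)
    finally show "(ennreal (cmod (cont_annihilate f g n t)))\<^sup>2 \<le>
      ?F * (\<integral>\<^sup>+s. ?J t s * (ennreal (cmod (g (Suc n) (case_nat s t))))\<^sup>2 \<partial>lebesgue_on {0..1})" .
  qed
  also have "\<dots> \<le> ?F * (\<integral>\<^sup>+t. \<integral>\<^sup>+s. ?J t s * (ennreal (cmod (g (Suc n) (case_nat s t))))\<^sup>2 \<partial>lebesgue_on {0..1} \<partial>simplex_measure n)"
    by (simp add: nn_integral_cmult slice_nn_integral_measurable[OF g2])
  also have "\<dots> = ?F * (\<integral>\<^sup>+t. (ennreal (cmod (g (Suc n) t)))\<^sup>2 \<partial>simplex_measure (Suc n))"
    by (simp add: nn_integral_simplex_Suc[OF g2])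
  finally show "(\<integral>\<^sup>+t. (ennreal (cmod (cont_annihilate f g n t)))\<^sup>2 \<partial>simplex_measure n) \<le> \<dots>" .
qed

lemma cont_create_fock:
  assumes f: "f \<in> L2 (lebesgue_on {0..1})" and g: "g \<in> cont_fock"
  shows "cont_create f g \<in> cont_fock"
proof -
  have gL: "\<And>n. g n \<in> L2 (simplex_measure n)"
    and gs: "summable (\<lambda>n. LINT t|simplex_measure n. (cmod (g n t))\<^sup>2)"
    using g by (auto simp: cont_fock_def)
  have "cont_create f g n \<in> L2 (simplex_measure n)" for n
  proof (cases n)
    case 0
    then show ?thesis by (simp add: cont_create_def L2_def)
  next
    case (Suc k)
    then show ?thesis using create_L2[where g=g, OF f gL] by blast
  qed
  moreover have "summable (\<lambda>n. LINT t|simplex_measure (Suc n). (cmod (cont_create f g (Suc n) t))\<^sup>2)"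
    by (rule summable_comparison_test'[OF summable_mult[OF gs]])
       (use create_L2[where g=g, OF f gL] in auto)
  then have "summable (\<lambda>n. LINT t|simplex_measure n. (cmod (cont_create f g n t))\<^sup>2)"
    by (rule summable_Suc_iff[THEN iffD1])
  ultimately show ?thesis by (simp add: cont_fock_def)
qed

lemma cont_annihilate_fock:
  assumes f: "f \<in> L2 (lebesgue_on {0..1})" and g: "g \<in> cont_fock"
  shows "cont_annihilate f g \<in> cont_fock"
proof -
  have gL: "\<And>n. g n \<in> L2 (simplex_measure n)"
    and gs: "summable (\<lambda>n. LINT t|simplex_measure (Suc n). (cmod (g (Suc n) t))\<^sup>2)"
    using g by (auto simp: cont_fock_def summable_Suc_iff[of "\<lambda>n. LINT t|simplex_measure n. (cmod (g n t))\<^sup>2"])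
  have "summable (\<lambda>n. LINT t|simplex_measure n. (cmod (cont_annihilate f g n t))\<^sup>2)"
    by (rule summable_comparison_test'[OF summable_mult[OF gs]])
       (use annihilate_L2[where g=g, OF f gL] in auto)
  with annihilate_L2[where g=g, OF f gL] show ?thesis by (simp add: cont_fock_def)
qed

lemma L2_mult_integrable:
  assumes "g \<in> L2 M" "h \<in> L2 M"
  shows "integrable M (\<lambda>x. cnj (g x) * h x)"
    and "cmod (LINT x|M. cnj (g x) * h x) \<le> (LINT x|M. (cmod (g x))\<^sup>2) + (LINT x|M. (cmod (h x))\<^sup>2)"
proof -
  have gm: "g \<in> borel_measurable M" and hm: "h \<in> borel_measurable M"
    and gi: "integrable M (\<lambda>x. (cmod (g x))\<^sup>2)" and hi: "integrable M (\<lambda>x. (cmod (h x))\<^sup>2)"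
    using assms by (auto simp: L2_def)
  have b: "cmod (cnj a * b) \<le> (cmod a)\<^sup>2 + (cmod b)\<^sup>2" for a b :: complex
  proof -
    have "0 \<le> cmod a * cmod b" by simp
    then show ?thesis
      using sum_squares_bound[of "cmod a" "cmod b"] unfolding norm_mult complex_mod_cnj by linarith
  qed
  show i: "integrable M (\<lambda>x. cnj (g x) * h x)"
  proof (rule Bochner_Integration.integrable_bound[OF Bochner_Integration.integrable_add[OF gi hi]])
    show "(\<lambda>x. cnj (g x) * h x) \<in> borel_measurable M"
      by (intro borel_measurable_times hm borel_measurable_continuous_on[where f=cnj] continuous_intros gm)
  qed (use b in auto)
  have "cmod (LINT x|M. cnj (g x) * h x) \<le> (LINT x|M. cmod (cnj (g x) * h x))"
    by (rule integral_norm_bound)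
  also have "\<dots> \<le> (LINT x|M. (cmod (g x))\<^sup>2 + (cmod (h x))\<^sup>2)"
    using i gi hi b by (intro integral_mono) auto
  also have "\<dots> = (LINT x|M. (cmod (g x))\<^sup>2) + (LINT x|M. (cmod (h x))\<^sup>2)"
    using gi hi by simp
  finally show "cmod (LINT x|M. cnj (g x) * h x) \<le> \<dots>" .
qed

lemma cont_adjoint:
  assumes f: "f \<in> L2 (lebesgue_on {0..1})" and g: "g \<in> cont_fock" and h: "h \<in> cont_fock"
  shows "cont_inner g (cont_create f h) = cont_inner (cont_annihilate f g) h"
proof -
  have L: "\<And>n. g n \<in> L2 (simplex_measure n)" "\<And>n. cont_create f h n \<in> L2 (simplex_measure n)"
    and s: "summable (\<lambda>n. LINT t|simplex_measure n. (cmod (g n t))\<^sup>2)"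
      "summable (\<lambda>n. LINT t|simplex_measure n. (cmod (cont_create f h n t))\<^sup>2)"
    using g cont_create_fock[OF f h] by (auto simp: cont_fock_def)
  let ?a = "\<lambda>n. LINT t|simplex_measure n. cnj (g n t) * cont_create f h n t"
  have sum: "summable ?a"
    by (rule summable_comparison_test'[OF summable_add[OF s]]) (use L2_mult_integrable(2)[OF L] in auto)
  have eq: "?a (Suc n) = (LINT t|simplex_measure n. cnj (cont_annihilate f g n t) * h n t)" for n
  proof -
    have "?a (Suc n) = (LINT t|simplex_measure n. (LINT s:{s. 0 < n \<longrightarrow> s < t 0}|lebesgue_on {0..1}.
        cnj (g (Suc n) (case_nat s t)) * (f s * h n t)))"
      using integral_simplex_Suc[OF L2_mult_integrable(1)[OF L]] by (simp add: cont_create_def)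
    also have "\<dots> = (LINT t|simplex_measure n. cnj (cont_annihilate f g n t) * h n t)"
    proof (rule Bochner_Integration.integral_cong[OF refl])
      fix t
      have "cnj (cont_annihilate f g n t) * h n t =
        (LINT s|lebesgue_on {0..1}. cnj (indicator {s. 0 < n \<longrightarrow> s < t 0} s *\<^sub>R
           (cnj (f s) * g (Suc n) (case_nat s t)))) * h n t"
        unfolding cont_annihilate_def set_lebesgue_integral_def
        by (rule arg_cong[where f="\<lambda>x. x * h n t"], rule Bochner_Integration.integral_cnj[symmetric])
      also have "\<dots> = (LINT s|lebesgue_on {0..1}. cnj (indicator {s. 0 < n \<longrightarrow> s < t 0} s *\<^sub>R
           (cnj (f s) * g (Suc n) (case_nat s t))) * h n t)"
        by (rule integral_mult_left_zero[symmetric])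
      finally show "(LINT s:{s. 0 < n \<longrightarrow> s < t 0}|lebesgue_on {0..1}.
        cnj (g (Suc n) (case_nat s t)) * (f s * h n t)) = cnj (cont_annihilate f g n t) * h n t"
        by (simp add: set_lebesgue_integral_def mult_ac)
    qed
    finally show ?thesis .
  qed
  have "cont_inner g (cont_create f h) = (\<Sum>n. ?a (Suc n)) + ?a 0"
    unfolding cont_inner_def using suminf_split_head[OF sum] by simp
  also have "\<dots> = cont_inner (cont_annihilate f g) h"
    unfolding cont_inner_def eq by (simp add: cont_create_def)
  finally show ?thesis .
qed

lemma AE_simplex_tail:
  assumes "AE t in simplex_measure n. P t"
  shows "AE t in simplex_measure (Suc n). P (\<lambda>i. t (Suc i))"
proof -
  obtain A where A: "{t \<in> space (simplex_measure n). \<not> P t} \<subseteq> A" "A \<in> null_sets (simplex_measure n)"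
    using assms by (auto elim: AE_E2 AE_E simp: null_sets_def)
  let ?u = "\<lambda>t. indicator A (\<lambda>i. t (Suc i)) :: ennreal"
  have u: "?u \<in> borel_measurable (simplex_measure (Suc n))"
    by (rule measurable_compose[OF tail_measurable_simplex]) (use A in auto)
  have "(\<integral>\<^sup>+t. ?u t \<partial>simplex_measure (Suc n)) =
      (\<integral>\<^sup>+t. \<integral>\<^sup>+s. indicator {s. 0 < n \<longrightarrow> s < t 0} s * indicator A t \<partial>lebesgue_on {0..1} \<partial>simplex_measure n)"
    by (simp add: nn_integral_simplex_Suc[OF u])
  also have "\<dots> = (\<integral>\<^sup>+t. 0 \<partial>simplex_measure n)"
    using A(2) by (intro nn_integral_cong_AE) (auto dest!: AE_not_in elim: eventually_mono)
  finally have "AE t in simplex_measure (Suc n). ?u t = 0"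
    using u by (simp add: nn_integral_0_iff_AE)
  then show ?thesis
  proof (rule AE_mp, intro AE_I2 impI)
    fix t assume "t \<in> space (simplex_measure (Suc n))" "?u t = 0"
    then show "P (\<lambda>i. t (Suc i))"
      using A(1) tail_incr_simplex[of t n] by (auto simp: space_simplex_measure split: if_splits simp: indicator_def)
  qed
qed

lemma cont_create_cong:
  assumes "cont_eq g h"
  shows "cont_eq (cont_create f g) (cont_create f h)"
  unfolding cont_eq_def
proof
  fix n
  show "AE t in simplex_measure n. cont_create f g n t = cont_create f h n t"
  proof (cases n)
    case (Suc k)
    have "AE t in simplex_measure k. g k t = h k t"
      using assms by (simp add: cont_eq_def)
    from AE_simplex_tail[OF this] show ?thesis
      unfolding Suc by eventually_elim (simp add: cont_create_def)
  qed (simp add: cont_create_def)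
qed

lemma cont_annihilate_cong:
  assumes f: "f \<in> L2 (lebesgue_on {0..1})" and g: "g \<in> cont_fock" and h: "h \<in> cont_fock"
    and eq: "cont_eq g h"
  shows "cont_eq (cont_annihilate f g) (cont_annihilate f h)"
  unfolding cont_eq_def
proof
  fix n
  have fm: "f \<in> borel_measurable (lebesgue_on {0..1})"
    and gm: "g (Suc n) \<in> borel_measurable (simplex_measure (Suc n))"
    and hm: "h (Suc n) \<in> borel_measurable (simplex_measure (Suc n))"
    using f g h by (auto simp: L2_def cont_fock_def)
  let ?u = "\<lambda>t. ennreal (cmod (g (Suc n) t - h (Suc n) t))"
  have u: "?u \<in> borel_measurable (simplex_measure (Suc n))"
    using gm hm by simp
  let ?I = "\<lambda>t. \<integral>\<^sup>+s. indicator {s. 0 < n \<longrightarrow> s < t 0} s * ?u (case_nat s t) \<partial>lebesgue_on {0..1}"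
  have "(\<integral>\<^sup>+t. ?I t \<partial>simplex_measure n) = (\<integral>\<^sup>+t. ?u t \<partial>simplex_measure (Suc n))"
    by (rule nn_integral_simplex_Suc[OF u, symmetric])
  also have "\<dots> = 0"
  proof (rule nn_integral_0_iff_AE[OF u, THEN iffD2])
    have "AE t in simplex_measure (Suc n). g (Suc n) t = h (Suc n) t"
      using eq by (simp add: cont_eq_def)
    then show "AE t in simplex_measure (Suc n). ?u t = 0" by eventually_elim simp
  qed
  finally have "AE t in simplex_measure n. ?I t = 0"
    by (rule nn_integral_0_iff_AE[OF slice_nn_integral_measurable[OF u], THEN iffD1])
  then show "AE t in simplex_measure n. cont_annihilate f g n t = cont_annihilate f h n t"
  proof (rule AE_mp, intro AE_I2 impI)
    fix t assume "t \<in> space (simplex_measure n)" and I: "?I t = 0"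
    then have t: "t \<in> incr_simplex n" by (simp add: space_simplex_measure)
    have "AE s in lebesgue_on {0..1}. indicator {s. 0 < n \<longrightarrow> s < t 0} s * ?u (case_nat s t) = 0"
      by (rule nn_integral_0_iff_AE[OF slice_measurable_ennreal[OF u t], THEN iffD1, OF I])
    then have ae: "AE s in lebesgue_on {0..1}.
        cnj (f s) * (indicator {s. 0 < n \<longrightarrow> s < t 0} s *\<^sub>R g (Suc n) (case_nat s t)) =
        cnj (f s) * (indicator {s. 0 < n \<longrightarrow> s < t 0} s *\<^sub>R h (Suc n) (case_nat s t))"
      by eventually_elim (auto split: split_indicator_asm split_indicator)
    have m: "(\<lambda>s. cnj (f s)) \<in> borel_measurable (lebesgue_on {0..1})"
      by (intro borel_measurable_continuous_on[where f=cnj] continuous_intros fm)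
    have "(LINT s|lebesgue_on {0..1}. cnj (f s) * (indicator {s. 0 < n \<longrightarrow> s < t 0} s *\<^sub>R g (Suc n) (case_nat s t))) =
        (LINT s|lebesgue_on {0..1}. cnj (f s) * (indicator {s. 0 < n \<longrightarrow> s < t 0} s *\<^sub>R h (Suc n) (case_nat s t)))"
      by (intro integral_cong_AE ae borel_measurable_times m slice_measurable gm hm t)
    then show "cont_annihilate f g n t = cont_annihilate f h n t"
      by (simp add: cont_annihilate_def set_lebesgue_integral_def)
  qed
qed

end

(* By induction on the word, its product applied to the vacuum is a scalar multiple of a product of
   one-variable functions restricted to increasing arguments: creation prepends a factor, and
   annihilation by f removes the first factor u and multiplies the next one by the primitive of
   cnj f * u (by the corresponding Riemann sum in the discrete case; for the last factor the
   integral enters the scalar). So it suffices that these operations preserve convergence of the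
   discrete factors to the continuous ones in the mean over the grid, and this holds for bounded
   functions whose mean oscillation over the cells of the grid tends to 0: Riemann sums of such
   functions converge to the primitive uniformly in the upper limit. *)

theory Submission
  imports Defs
begin

section \<open>Averages over the grid\<close>

definition mean :: "nat \<Rightarrow> (nat \<Rightarrow> real) \<Rightarrow> real" where
  "mean N g = (\<Sum>k=1..N. g k) / real N"

lemma mean_nonneg: "(\<And>k. k \<in> {1..N} \<Longrightarrow> 0 \<le> g k) \<Longrightarrow> 0 \<le> mean N g"
  unfolding mean_def by (intro divide_nonneg_nonneg sum_nonneg) auto

lemma mean_mono: "(\<And>k. k \<in> {1..N} \<Longrightarrow> g k \<le> h k) \<Longrightarrow> mean N g \<le> mean N h"
  unfolding mean_def by (intro divide_right_mono sum_mono) auto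

lemma mean_add: "mean N (\<lambda>k. g k + h k) = mean N g + mean N h"
  by (simp add: mean_def sum.distrib add_divide_distrib)

lemma mean_cmult: "mean N (\<lambda>k. c * g k) = c * mean N g"
  by (simp add: mean_def sum_distrib_left)

lemma mean_const: "1 \<le> N \<Longrightarrow> mean N (\<lambda>_. c) = c"
  by (simp add: mean_def)

text \<open>The bounds are asked for \<open>1 \<le> N\<close> only: at \<open>N = 0\<close> division
  by zero makes every mean 0, so that estimates through \<open>mean_const\<close> start at
  1.\<close>

lemma tendsto_zero_dominated:
  fixes a b :: "nat \<Rightarrow> real"
  assumes "b \<longlonglongrightarrow> 0" "\<And>N. 1 \<le> N \<Longrightarrow> 0 \<le> a N" "\<And>N. 1 \<le> N \<Longrightarrow> a N \<le> b N"
  shows "a \<longlonglongrightarrow> 0"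
  by (rule tendsto_sandwich[OF _ _ tendsto_const assms(1)])
     (use assms in \<open>auto intro!: eventually_sequentiallyI[of 1]\<close>)

section \<open>Cells of the grid and regular functions\<close>

text \<open>The sampling points \<open>k / N\<close> of \<open>disc_S\<close> are the right ends of
  the cells. The cells are closed so that they can form a tagged division.\<close>

definition cell :: "nat \<Rightarrow> nat \<Rightarrow> real set" where
  "cell N k = {(real k - 1) / real N .. real k / real N}"

lemma cell_subset: "k \<in> {1..N} \<Longrightarrow> cell N k \<subseteq> {0..1}"
  by (auto simp: cell_def field_simps)

lemma right_end_in_cell: "k \<in> {1..N} \<Longrightarrow> real k / real N \<in> cell N k"
  by (auto simp: cell_def field_simps)

lemma right_end_in_unit: "k \<in> {1..N} \<Longrightarrow> real k / real N \<in> {0..1}"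
  by (auto simp: field_simps)

text \<open>Quantifying over all choices of points in the cells replaces suprema: a choice that
  nearly attains each supremum shows that the last condition says that the mean oscillation about
  the right ends tends to 0. Measurability and boundedness give access to the integral in
  \<open>primitive\<close>.\<close>

definition riemann_regular :: "(real \<Rightarrow> complex) \<Rightarrow> bool" where
  "riemann_regular u \<longleftrightarrow> u \<in> borel_measurable (lebesgue_on {0..1}) \<and> bounded (u ` {0..1}) \<and>
     (\<forall>y. (\<forall>N. \<forall>k\<in>{1..N}. y N k \<in> cell N k) \<longrightarrow>
        (\<lambda>N. mean N (\<lambda>k. cmod (u (real k / real N) - u (y N k)))) \<longlonglongrightarrow> 0)"

text \<open>Discrete L1 convergence of \<open>V N\<close> to the samples of \<open>u\<close>, which
  bounds differences of Riemann sums directly.\<close>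

definition mean_approx :: "(nat \<Rightarrow> nat \<Rightarrow> complex) \<Rightarrow> (real \<Rightarrow> complex) \<Rightarrow> bool" where
  "mean_approx V u \<longleftrightarrow> (\<lambda>N. mean N (\<lambda>k. cmod (V N k - u (real k / real N)))) \<longlonglongrightarrow> 0"

lemma bounded_unitE:
  fixes u :: "real \<Rightarrow> complex"
  assumes "bounded (u ` {0..1})"
  obtains B where "0 \<le> B" "\<And>t. t \<in> {0..1} \<Longrightarrow> cmod (u t) \<le> B"
  using assms unfolding bounded_pos by (meson imageI less_imp_le)

text \<open>The intermediate term is \<open>c * b\<close>, so the differences are weighted by
  \<open>b\<close> and \<open>c\<close>. In \<open>mean_approx_mult_primitive\<close> these two have
  pointwise bounds, while \<open>a\<close> is controlled only in the mean.\<close>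

lemma cmod_mult_diff:
  "cmod (a * b - c * d) \<le> cmod b * cmod (a - c) + cmod c * cmod (b - d)"
proof -
  have "a * b - c * d = (a - c) * b + c * (b - d)" by (simp add: algebra_simps)
  then show ?thesis
    by (metis norm_mult norm_triangle_ineq mult.commute)
qed

lemma riemann_regular_mult:
  assumes u: "riemann_regular u" and v: "riemann_regular v"
  shows "riemann_regular (\<lambda>t. u t * v t)"
  unfolding riemann_regular_def
proof (intro conjI allI impI)
  show "(\<lambda>t. u t * v t) \<in> borel_measurable (lebesgue_on {0..1})"
    using u v by (auto simp: riemann_regular_def)
  obtain A where A: "0 \<le> A" "\<And>t. t \<in> {0..1} \<Longrightarrow> cmod (u t) \<le> A"
    using u by (auto simp: riemann_regular_def elim: bounded_unitE)
  obtain B where B: "0 \<le> B" "\<And>t. t \<in> {0..1} \<Longrightarrow> cmod (v t) \<le> B"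
    using v by (auto simp: riemann_regular_def elim: bounded_unitE)
  show "bounded ((\<lambda>t. u t * v t) ` {0..1})"
    unfolding bounded_iff using A B
    by (intro exI[of _ "A * B"]) (auto simp: norm_mult intro!: mult_mono)
  fix y :: "nat \<Rightarrow> nat \<Rightarrow> real" assume y: "\<forall>N. \<forall>k\<in>{1..N}. y N k \<in> cell N k"
  show "(\<lambda>N. mean N (\<lambda>k. cmod (u (real k / real N) * v (real k / real N) - u (y N k) * v (y N k)))) \<longlonglongrightarrow> 0"
  proof (rule tendsto_zero_dominated)
    show "(\<lambda>N. B * mean N (\<lambda>k. cmod (u (real k / real N) - u (y N k)))
        + A * mean N (\<lambda>k. cmod (v (real k / real N) - v (y N k)))) \<longlonglongrightarrow> 0"
      using u v y unfolding riemann_regular_def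
      by (intro tendsto_add_zero tendsto_mult_right_zero) auto
    fix N :: nat
    show "0 \<le> mean N (\<lambda>k. cmod (u (real k / real N) * v (real k / real N) - u (y N k) * v (y N k)))"
      by (rule mean_nonneg) simp
    show "mean N (\<lambda>k. cmod (u (real k / real N) * v (real k / real N) - u (y N k) * v (y N k)))
      \<le> B * mean N (\<lambda>k. cmod (u (real k / real N) - u (y N k)))
        + A * mean N (\<lambda>k. cmod (v (real k / real N) - v (y N k)))"
      unfolding mean_cmult[symmetric] mean_add[symmetric]
    proof (rule mean_mono)
      fix k assume k: "k \<in> {1..N}"
      then have "y N k \<in> {0..1}" using y cell_subset by blast
      with right_end_in_unit[OF k] A B
      show "cmod (u (real k / real N) * v (real k / real N) - u (y N k) * v (y N k))
        \<le> B * cmod (u (real k / real N) - u (y N k)) + A * cmod (v (real k / real N) - v (y N k))"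
        by (intro order_trans[OF cmod_mult_diff] add_mono mult_right_mono) auto
    qed
  qed
qed

lemma riemann_regular_cnj:
  assumes u: "riemann_regular u"
  shows "riemann_regular (\<lambda>t. cnj (u t))"
  unfolding riemann_regular_def
proof (intro conjI allI impI)
  show "(\<lambda>t. cnj (u t)) \<in> borel_measurable (lebesgue_on {0..1})"
    using u by (intro borel_measurable_continuous_on[where f=cnj] continuous_intros)
      (auto simp: riemann_regular_def)
qed (use u in \<open>auto simp: riemann_regular_def bounded_iff simp flip: complex_cnj_diff\<close>)

section \<open>Primitives of regular functions\<close>

text \<open>The strict inequality is that of the domain of integration in
  \<open>cont_annihilate\<close> at levels \<open>n > 0\<close>.\<close>

definition primitive :: "(real \<Rightarrow> complex) \<Rightarrow> real \<Rightarrow> complex" where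
  "primitive u t = (LINT s:{s. s < t}|lebesgue_on {0..1}. u s)"

lemma bounded_integrable_unit:
  fixes u :: "real \<Rightarrow> complex"
  assumes "u \<in> borel_measurable (lebesgue_on {0..1})" "bounded (u ` {0..1})"
  shows "integrable (lebesgue_on {0..1}) u"
proof -
  interpret finite_measure "lebesgue_on {0..1::real}"
    by (rule finite_measure_lebesgue_on) simp
  obtain B where "\<And>t. t \<in> {0..1} \<Longrightarrow> cmod (u t) \<le> B"
    using bounded_unitE[OF assms(2)] by blast
  then show ?thesis
    using assms(1) by (intro integrable_const_bound[where B=B]) (auto intro!: AE_I2)
qed

lemma lebesgue_integral_unit:
  fixes u :: "real \<Rightarrow> complex"
  assumes "u \<in> borel_measurable (lebesgue_on {0..1})" "bounded (u ` {0..1})"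
  shows "(LINT s|lebesgue_on {0..1}. u s) = integral {0..1} u" "u integrable_on {0..1}"
  using bounded_integrable_unit[OF assms]
  by (auto intro: lebesgue_integral_eq_integral integrable_on_lebesgue_on)

text \<open>Passing to the gauge integral gives additivity over adjacent intervals; the strict bound
  \<open>s < t\<close> changes the integrand at most on the null set \<open>{t}\<close>.\<close>

lemma primitive_eq_integral:
  assumes "u \<in> borel_measurable (lebesgue_on {0..1})" "bounded (u ` {0..1})" "t \<in> {0..1}"
  shows "primitive u t = integral {0..t} u"
proof -
  let ?v = "\<lambda>s. indicator {s. s < t} s *\<^sub>R u s"
  have m: "?v \<in> borel_measurable (lebesgue_on {0..1})"
  proof (intro borel_measurable_scaleR assms borel_measurable_indicator')
    have "{0..1} \<inter> {..<t} \<in> sets (lebesgue_on {0..1})"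
      by (simp add: sets_restrict_space_iff)
    then show "{x \<in> space (lebesgue_on {0..1}). x \<in> {s. s < t}} \<in> sets (lebesgue_on {0..1})"
      by (simp add: Int_def)
  qed
  obtain B where "0 \<le> B" "\<And>t. t \<in> {0..1} \<Longrightarrow> cmod (u t) \<le> B"
    using bounded_unitE[OF assms(2)] by blast
  then have b: "bounded (?v ` {0..1})"
    unfolding bounded_iff by (intro exI[of _ B]) (auto simp: indicator_def)
  have "primitive u t = integral {0..1} ?v"
    unfolding primitive_def set_lebesgue_integral_def by (rule lebesgue_integral_unit[OF m b])
  also have "\<dots> = integral {0..1} (\<lambda>s. if s \<in> {0..t} then u s else 0)"
    by (rule integral_spike[of "{t}"]) (auto simp: indicator_def)
  also have "\<dots> = integral {0..t} u"
    unfolding integral_restrict_Int using assms(3) by (simp add: Int_absorb2)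
  finally show ?thesis .
qed


lemma primitive_diff:
  assumes u: "u \<in> borel_measurable (lebesgue_on {0..1})" "bounded (u ` {0..1})"
    and st: "0 \<le> s" "s \<le> t" "t \<le> 1"
  shows "primitive u t = primitive u s + integral {s..t} u"
proof -
  have "u integrable_on {0..t}"
    by (rule integrable_on_subinterval[OF lebesgue_integral_unit(2)[OF u]]) (use st in auto)
  then have "integral {0..s} u + integral {s..t} u = integral {0..t} u"
    using st by (intro Henstock_Kurzweil_Integration.integral_combine) auto
  then show ?thesis using st by (simp add: primitive_eq_integral[OF u])
qed

text \<open>Serves twice: with \<open>c = 0\<close> for the Lipschitz bound, and with
  \<open>c\<close> the value of \<open>u\<close> at the right end of a cell.\<close>

lemma norm_integral_diff_le:
  fixes u :: "real \<Rightarrow> complex"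
  assumes "u integrable_on {s..t}" "s \<le> t" "0 \<le> B"
    and "\<And>x. x \<in> {s..t} \<Longrightarrow> cmod (u x - c) \<le> B"
  shows "cmod (integral {s..t} u - of_real (t - s) * c) \<le> B * (t - s)"
proof -
  have "((\<lambda>x. u x - c) has_integral (integral {s..t} u - (t - s) *\<^sub>R c)) (cbox s t)"
    using assms(1) has_integral_const_real[of c s t] assms(2)
    by (intro has_integral_diff) (auto simp: integrable_integral)
  from has_integral_bound[OF assms(3) this] show ?thesis
    using assms by (simp add: scaleR_conv_of_real)
qed

lemma primitive_lipschitz:
  assumes u: "u \<in> borel_measurable (lebesgue_on {0..1})" "bounded (u ` {0..1})"
  obtains B where "0 \<le> B"
    "\<And>s t. s \<in> {0..1} \<Longrightarrow> t \<in> {0..1} \<Longrightarrow> cmod (primitive u s - primitive u t) \<le> B * \<bar>s - t\<bar>"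
proof -
  obtain B where B: "0 \<le> B" "\<And>t. t \<in> {0..1} \<Longrightarrow> cmod (u t) \<le> B"
    using bounded_unitE[OF u(2)] by blast
  have le: "cmod (primitive u t - primitive u s) \<le> B * (t - s)" if "0 \<le> s" "s \<le> t" "t \<le> 1" for s t
  proof -
    have "u integrable_on {s..t}"
      by (rule integrable_on_subinterval[OF lebesgue_integral_unit(2)[OF u]]) (use that in auto)
    from norm_integral_diff_le[OF this, of B 0] show ?thesis
      using that B by (simp add: primitive_diff[OF u that])
  qed
  show ?thesis
  proof (rule that[OF B(1)])
    fix s t :: real assume "s \<in> {0..1}" "t \<in> {0..1}"
    then show "cmod (primitive u s - primitive u t) \<le> B * \<bar>s - t\<bar>"
      using le[of s t] le[of t s] by (cases "s \<le> t") (auto simp: norm_minus_commute)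
  qed
qed

text \<open>The primitive of a bounded function is Lipschitz, and a cell has width
  \<open>1 / N\<close>, so the oscillation over each cell is at most \<open>B / N\<close>.\<close>

lemma riemann_regular_primitive:
  assumes "riemann_regular u"
  shows "riemann_regular (primitive u)"
proof -
  have u: "u \<in> borel_measurable (lebesgue_on {0..1})" "bounded (u ` {0..1})"
    using assms by (auto simp: riemann_regular_def)
  obtain B where B: "0 \<le> B"
    "\<And>s t. s \<in> {0..1} \<Longrightarrow> t \<in> {0..1} \<Longrightarrow> cmod (primitive u s - primitive u t) \<le> B * \<bar>s - t\<bar>"
    using primitive_lipschitz[OF u] by blast
  have "B-lipschitz_on {0..1} (primitive u)"
    using B by (intro lipschitz_onI) (auto simp: dist_norm)
  then have c: "continuous_on {0..1} (primitive u)"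
    by (rule lipschitz_on_continuous_on)
  show ?thesis
    unfolding riemann_regular_def
  proof (intro conjI allI impI)
    show "primitive u \<in> borel_measurable (lebesgue_on {0..1})"
      using c by (rule continuous_imp_measurable_on_sets_lebesgue) simp
    show "bounded (primitive u ` {0..1})"
      by (intro compact_imp_bounded compact_continuous_image c) simp
    fix y :: "nat \<Rightarrow> nat \<Rightarrow> real" assume y: "\<forall>N. \<forall>k\<in>{1..N}. y N k \<in> cell N k"
    show "(\<lambda>N. mean N (\<lambda>k. cmod (primitive u (real k / real N) - primitive u (y N k)))) \<longlonglongrightarrow> 0"
    proof (rule tendsto_zero_dominated)
      show "(\<lambda>N. B * (1 / real N)) \<longlonglongrightarrow> 0"
        by (intro tendsto_mult_right_zero lim_1_over_n)
      fix N :: nat assume N: "1 \<le> N"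
      show "0 \<le> mean N (\<lambda>k. cmod (primitive u (real k / real N) - primitive u (y N k)))"
        by (rule mean_nonneg) simp
      have "mean N (\<lambda>k. cmod (primitive u (real k / real N) - primitive u (y N k))) \<le> mean N (\<lambda>_. B * (1 / real N))"
      proof (rule mean_mono)
        fix k assume k: "k \<in> {1..N}"
        then have yk: "y N k \<in> cell N k" using y by blast
        then have "\<bar>real k / real N - y N k\<bar> \<le> 1 / real N"
          using N by (auto simp: cell_def diff_divide_distrib)
        then have "B * \<bar>real k / real N - y N k\<bar> \<le> B * (1 / real N)"
          by (rule mult_left_mono) (rule B)
        with B(2)[OF right_end_in_unit[OF k], of "y N k"] yk cell_subset[OF k]
        show "cmod (primitive u (real k / real N) - primitive u (y N k)) \<le> B * (1 / real N)"
          by auto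
      qed
      also have "\<dots> = B * (1 / real N)" by (rule mean_const[OF N])
      finally show "mean N (\<lambda>k. cmod (primitive u (real k / real N) - primitive u (y N k))) \<le> \<dots>" .
    qed
  qed
qed

section \<open>Uniform convergence of Riemann sums\<close>

text \<open>The error on a cell is at most the width times the supremum of the deviation from the
  right end. That supremum may not be attained; the slack \<open>1 / N\<close> allows a single point
  \<open>y\<close> to take its place, as the form of \<open>riemann_regular\<close> requires, and
  vanishes in the limit.\<close>

lemma cell_mean_value:
  assumes "riemann_regular u" and k: "k \<in> {1..N}"
  shows "\<exists>y\<in>cell N k. cmod (integral (cell N k) u - u (real k / real N) / real N)
    \<le> (cmod (u (real k / real N) - u y) + 1 / real N) / real N"
proof (rule ccontr)
  let ?c = "cmod (integral (cell N k) u - u (real k / real N) / real N)"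
  assume "\<not> ?thesis"
  then have *: "cmod (u y - u (real k / real N)) \<le> real N * ?c - 1 / real N" if "y \<in> cell N k" for y
    using that k by (force simp: field_simps not_le norm_minus_commute)
  have N: "0 < real N" using k by auto
  have "u \<in> borel_measurable (lebesgue_on {0..1})" "bounded (u ` {0..1})"
    using assms by (auto simp: riemann_regular_def)
  note i = integrable_on_subinterval[OF lebesgue_integral_unit(2)[OF this] cell_subset[OF k, unfolded cell_def]]
  have l: "real k / real N - (real k - 1) / real N = 1 / real N"
    by (simp add: diff_divide_distrib)
  \<comment> \<open>The right end is itself a point of the cell, and there the left side of
    \<open>*\<close> is 0.\<close>
  have c0: "0 \<le> real N * ?c - 1 / real N"
    using *[OF right_end_in_cell[OF k]] by simp
  from norm_integral_diff_le[OF i _ c0[unfolded cell_def] *[unfolded cell_def]]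
  have "?c \<le> (real N * ?c - 1 / real N) * (1 / real N)"
    using N unfolding l by (simp add: cell_def divide_right_mono)
  also have "\<dots> = ?c - (1 / real N) * (1 / real N)"
    using N by (simp add: field_simps)
  moreover have "0 < (1 / real N) * (1 / real N)"
    using N by (intro mult_pos_pos) auto
  ultimately show False by linarith
qed

lemma primitive_grid:
  assumes u: "riemann_regular u" and "k \<le> N" "1 \<le> N"
  shows "primitive u (real k / real N) = (\<Sum>j=1..k. integral (cell N j) u)"
  using assms(2)
proof (induction k)
  case 0
  show ?case
    using primitive_eq_integral[of u 0] u by (simp add: riemann_regular_def)
next
  case (Suc k)
  have "primitive u (real (Suc k) / real N) = primitive u (real k / real N) + integral (cell N (Suc k)) u"
    using primitive_diff[of u "real k / real N" "real (Suc k) / real N"] u Suc.prems assms(3)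
    by (auto simp: riemann_regular_def cell_def divide_right_mono)
  with Suc show ?case by simp
qed

text \<open>The error of a partial sum is at most the sum of the errors on all cells, which does not
  depend on \<open>k\<close>. The version over \<open>{1..<k}\<close> is the one produced by
  discrete annihilation, where the removed index is strictly below the next one; the version over
  \<open>{1..k}\<close> gives the full integral at \<open>k = N\<close>.\<close>

lemma riemann_sum_uniform:
  assumes u: "riemann_regular u" and V: "mean_approx V u"
  obtains \<delta> where "\<delta> \<longlonglongrightarrow> 0"
    "\<And>N k. k \<in> {1..N} \<Longrightarrow> cmod ((\<Sum>j=1..k. V N j) / real N - primitive u (real k / real N)) \<le> \<delta> N"
    "\<And>N k. k \<in> {1..N} \<Longrightarrow> cmod ((\<Sum>j\<in>{1..<k}. V N j) / real N - primitive u (real k / real N)) \<le> \<delta> N"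
proof -
  have "\<forall>N k. \<exists>y. k \<in> {1..N} \<longrightarrow> y \<in> cell N k \<and> cmod (integral (cell N k) u - u (real k / real N) / real N)
    \<le> (cmod (u (real k / real N) - u y) + 1 / real N) / real N"
    using cell_mean_value[OF u] by blast
  then obtain y where y: "\<And>N k. k \<in> {1..N} \<Longrightarrow> y N k \<in> cell N k"
    "\<And>N k. k \<in> {1..N} \<Longrightarrow> cmod (integral (cell N k) u - u (real k / real N) / real N)
       \<le> (cmod (u (real k / real N) - u (y N k)) + 1 / real N) / real N"
    unfolding choice_iff by blast
  have "bounded (u ` {0..1})" using u by (simp add: riemann_regular_def)
  then obtain B where B: "0 \<le> B" "\<And>t. t \<in> {0..1} \<Longrightarrow> cmod (u t) \<le> B"
    using bounded_unitE by blast
  \<comment> \<open>\<open>?e N k / N\<close> bounds the error on cell \<open>k\<close>: the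
    distance of \<open>V N k\<close> from the sample of \<open>u\<close>, plus the bound of
    \<open>cell_mean_value\<close>.\<close>
  let ?e = "\<lambda>N k. cmod (V N k - u (real k / real N)) + (cmod (u (real k / real N) - u (y N k)) + 1 / real N)"
  \<comment> \<open>One mean accounts for the sum up to \<open>k\<close>; the other one and
    \<open>B / N\<close> account for the single term \<open>V N k / N\<close> that the sum over
    \<open>{1..<k}\<close> omits.\<close>
  let ?\<delta> = "\<lambda>N. 2 * mean N (?e N) + B * (1 / real N)"
  have mean_e: "mean N (?e N) = mean N (\<lambda>k. cmod (V N k - u (real k / real N)))
      + (mean N (\<lambda>k. cmod (u (real k / real N) - u (y N k))) + 1 / real N)" if "1 \<le> N" for N
    using that by (simp add: mean_add mean_const)
  have e0: "0 \<le> mean N (?e N)" for N by (rule mean_nonneg) auto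
  have e: "(\<lambda>N. mean N (?e N)) \<longlonglongrightarrow> 0"
  proof (rule tendsto_zero_dominated)
    show "(\<lambda>N. mean N (\<lambda>k. cmod (V N k - u (real k / real N)))
      + (mean N (\<lambda>k. cmod (u (real k / real N) - u (y N k))) + 1 / real N)) \<longlonglongrightarrow> 0"
      using u V y unfolding riemann_regular_def mean_approx_def
      by (intro tendsto_add_zero lim_1_over_n) auto
    fix N :: nat assume "1 \<le> N"
    then show "mean N (?e N) \<le> mean N (\<lambda>k. cmod (V N k - u (real k / real N)))
      + (mean N (\<lambda>k. cmod (u (real k / real N) - u (y N k))) + 1 / real N)"
      by (simp only: mean_e order_refl)
  qed (rule e0)
  have full: "cmod ((\<Sum>j=1..k. V N j) / real N - primitive u (real k / real N)) \<le> mean N (?e N)"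
    if k: "k \<in> {1..N}" for N k
  proof -
    have N: "1 \<le> N" "k \<le> N" using k by auto
    have "cmod ((\<Sum>j=1..k. V N j) / real N - primitive u (real k / real N))
      = cmod (\<Sum>j=1..k. V N j / real N - integral (cell N j) u)"
      using N by (simp add: primitive_grid[OF u] sum_subtractf sum_divide_distrib)
    also have "\<dots> \<le> (\<Sum>j=1..k. ?e N j / real N)"
    proof (rule sum_norm_le)
      fix j assume "j \<in> {1..k}"
      then have j: "j \<in> {1..N}" using N by auto
      have "V N j / real N - integral (cell N j) u = (V N j - u (real j / real N)) / real N
          - (integral (cell N j) u - u (real j / real N) / real N)"
        by (simp add: diff_divide_distrib)
      then have "cmod (V N j / real N - integral (cell N j) u) \<le> cmod ((V N j - u (real j / real N)) / real N)
          + cmod (integral (cell N j) u - u (real j / real N) / real N)"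
        by (metis norm_triangle_ineq4)
      also have "\<dots> \<le> cmod (V N j - u (real j / real N)) / real N
          + (cmod (u (real j / real N) - u (y N j)) + 1 / real N) / real N"
        using y(2)[OF j] by (simp add: norm_divide)
      finally show "cmod (V N j / real N - integral (cell N j) u) \<le> ?e N j / real N"
        by (simp add: add_divide_distrib)
    qed
    \<comment> \<open>Extending the sum of nonnegative terms to the whole grid makes the bound
      independent of \<open>k\<close>.\<close>
    also have "\<dots> \<le> (\<Sum>j=1..N. ?e N j / real N)"
      using N by (intro sum_mono2) auto
    also have "\<dots> = mean N (?e N)" by (simp add: mean_def sum_divide_distrib)
    finally show ?thesis .
  qed
  show ?thesis
  proof (rule that)
    show "?\<delta> \<longlonglongrightarrow> 0"
      by (intro tendsto_add_zero tendsto_mult_right_zero lim_1_over_n e)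
    fix N k :: nat assume k: "k \<in> {1..N}"
    show "cmod ((\<Sum>j=1..k. V N j) / real N - primitive u (real k / real N)) \<le> ?\<delta> N"
      using full[OF k] e0[of N] B(1) by (intro order_trans[OF full[OF k]]) simp
    \<comment> \<open>A single deviation is at most the sum of all of them. So, although
      \<open>V\<close> is close to \<open>u\<close> only in the mean, every \<open>V N k / N\<close>
      is uniformly small.\<close>
    have "?e N k \<le> (\<Sum>j=1..N. ?e N j)"
      using k by (intro member_le_sum) auto
    then have "cmod (V N k - u (real k / real N)) \<le> (\<Sum>j=1..N. ?e N j)"
      using norm_ge_zero[of "u (real k / real N) - u (y N k)"] by (smt (verit) divide_nonneg_nonneg of_nat_0_le_iff)
    then have "cmod (V N k) \<le> (\<Sum>j=1..N. ?e N j) + B"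
      using B(2)[OF right_end_in_unit[OF k]] norm_triangle_ineq[of "V N k - u (real k / real N)" "u (real k / real N)"]
      by simp
    then have Vk: "cmod (V N k / real N) \<le> mean N (?e N) + B * (1 / real N)"
      by (simp add: norm_divide mean_def divide_right_mono flip: add_divide_distrib)
    have "{1..k} = insert k {1..<k}" using k by auto
    then have "(\<Sum>j\<in>{1..<k}. V N j) / real N - primitive u (real k / real N)
       = ((\<Sum>j=1..k. V N j) / real N - primitive u (real k / real N)) - V N k / real N"
      by (simp add: add_divide_distrib)
    then have "cmod ((\<Sum>j\<in>{1..<k}. V N j) / real N - primitive u (real k / real N))
      \<le> cmod ((\<Sum>j=1..k. V N j) / real N - primitive u (real k / real N)) + cmod (V N k / real N)"
      by (metis norm_triangle_ineq4)
    then show "cmod ((\<Sum>j\<in>{1..<k}. V N j) / real N - primitive u (real k / real N)) \<le> ?\<delta> N"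
      using full[OF k] Vk by simp
  qed
qed

section \<open>Riemann integrable functions are regular\<close>

lemma cell_tagged_division:
  assumes N: "1 \<le> N" and z: "\<And>k. k \<in> {1..N} \<Longrightarrow> z k \<in> cell N k"
  shows "(\<lambda>k. (z k, cell N k)) ` {1..N} tagged_division_of {0..1}"
  unfolding tagged_division_of
proof (intro conjI allI impI)
  show "finite ((\<lambda>k. (z k, cell N k)) ` {1..N})" by simp
next
  fix x K assume "(x, K) \<in> (\<lambda>k. (z k, cell N k)) ` {1..N}"
  then obtain k where k: "k \<in> {1..N}" "x = z k" "K = cell N k" by auto
  with z cell_subset show "x \<in> K" "K \<subseteq> {0..1}" by auto
  show "\<exists>a b. K = cbox a b" unfolding k cell_def by (intro exI) (rule cbox_interval[symmetric])
next
  fix x1 K1 x2 K2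
  assume "(x1, K1) \<in> (\<lambda>k. (z k, cell N k)) ` {1..N} \<and>
      (x2, K2) \<in> (\<lambda>k. (z k, cell N k)) ` {1..N} \<and> (x1, K1) \<noteq> (x2, K2)"
  then obtain k l where kl: "K1 = cell N k" "K2 = cell N l" "k \<noteq> l" by auto
  have disj: "interior (cell N k) \<inter> interior (cell N l) = {}" if "k < l" for k l
  proof -
    have "real k / real N \<le> (real l - 1) / real N"
      using that by (intro divide_right_mono) auto
    then show ?thesis by (auto simp: cell_def)
  qed
  show "interior K1 \<inter> interior K2 = {}"
    using disj[of k l] disj[of l k] kl by (cases "k < l") auto
next
  have "x \<in> (\<Union>k\<in>{1..N}. cell N k)" if x: "x \<in> {0..1}" for x
  proof (cases "x = 0")
    case True
    then show ?thesis using N by (auto simp: cell_def intro!: bexI[of _ 1])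
  next
    case False
    \<comment> \<open>The ceiling of \<open>x * N\<close> is the index of a cell containing
      \<open>x\<close>. It would be 0 for \<open>x = 0\<close>, which is why that point is assigned
      to cell 1 separately.\<close>
    let ?k = "nat \<lceil>x * real N\<rceil>"
    have "0 < x * real N" using x False N by simp
    then have k: "real ?k = of_int \<lceil>x * real N\<rceil>" by linarith
    then have "real ?k - 1 < x * real N" "x * real N \<le> real ?k" by linarith+
    then have "x \<in> cell N ?k" using N by (auto simp: cell_def field_simps)
    moreover have "x * real N \<le> 1 * real N" using x by (intro mult_right_mono) auto
    then have "?k \<in> {1..N}" using \<open>0 < x * real N\<close> by (simp add: nat_le_iff ceiling_le_iff Suc_le_eq)
    ultimately show ?thesis by blast
  qed
  moreover have "\<Union> {K. \<exists>x. (x, K) \<in> (\<lambda>k. (z k, cell N k)) ` {1..N}} = (\<Union>k\<in>{1..N}. cell N k)"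
    by auto
  ultimately show "\<Union> {K. \<exists>x. (x, K) \<in> (\<lambda>k. (z k, cell N k)) ` {1..N}} = {0..1}"
    using cell_subset by blast
qed

text \<open>A tagged division is a set of pairs; injectivity turns the sum over it into a sum over
  \<open>k\<close>. It holds because equal cells contain each other's right ends.\<close>

lemma cell_inj: "1 \<le> N \<Longrightarrow> inj_on (\<lambda>k. (z k, cell N k)) {1..N}"
proof (rule inj_onI)
  fix k l assume "1 \<le> N" "k \<in> {1..N}" "l \<in> {1..N}" "(z k, cell N k) = (z l, cell N l)"
  then have "real k / real N \<in> cell N l" "real l / real N \<in> cell N k"
    using right_end_in_cell by auto
  then show "k = l" using \<open>1 \<le> N\<close> by (auto simp: cell_def divide_le_cancel)
qed

text \<open>Riemann sums with the same partition but different tags are close; exchanging the two tags of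
  each cell so that all real (or all imaginary) parts of the differences become nonnegative turns
  this into a bound for the mean oscillation.\<close>

lemma Rinf_riemann_regular:
  assumes f: "f \<in> Rinf"
  shows "riemann_regular f"
  unfolding riemann_regular_def
proof (intro conjI allI impI)
  show "f \<in> borel_measurable (lebesgue_on {0..1})"
    using Rinf_L2[OF f] by (simp add: L2_def)
  show "bounded (f ` {0..1})" using f by (simp add: Rinf_def)
  from f obtain I where I: "\<And>e. e > 0 \<Longrightarrow> \<exists>d>0. \<forall>p. p tagged_division_of {0..1} \<and> (\<forall>(x, K)\<in>p. diameter K < d) \<longrightarrow>
        norm ((\<Sum>(x, K)\<in>p. measure lborel K *\<^sub>R f x) - I) < e"
    by (auto simp: Rinf_def riemann_integrable_on_def)
  fix y :: "nat \<Rightarrow> nat \<Rightarrow> real" assume y: "\<forall>N. \<forall>k\<in>{1..N}. y N k \<in> cell N k"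
  show "(\<lambda>N. mean N (\<lambda>k. cmod (f (real k / real N) - f (y N k)))) \<longlonglongrightarrow> 0"
  proof (rule LIMSEQ_I)
    fix r :: real assume "0 < r"
    \<comment> \<open>Two Riemann sums within \<open>r / 4\<close> of \<open>I\<close> differ by
      less than \<open>r / 2\<close>, and this is used once for real and once for imaginary
      parts.\<close>
    then have "0 < r / 4" by simp
    from I[OF this] obtain d where d0: "0 < d" and d1: "\<forall>p. p tagged_division_of {0..1} \<and> (\<forall>(x, K)\<in>p. diameter K < d) \<longrightarrow>
        norm ((\<Sum>(x, K)\<in>p. measure lborel K *\<^sub>R f x) - I) < r / 4"
      by blast
    have d: "0 < d"
      "\<And>p. p tagged_division_of {0..1} \<Longrightarrow> (\<And>x K. (x, K) \<in> p \<Longrightarrow> diameter K < d) \<Longrightarrow>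
        cmod ((\<Sum>(x, K)\<in>p. measure lborel K *\<^sub>R f x) - I) < r / 4"
      using d0 d1 by auto
    obtain N0 where N0: "1 / d < real N0" using reals_Archimedean2 by blast
    have "cmod (mean N (\<lambda>k. cmod (f (real k / real N) - f (y N k))) - 0) < r"
      if "N \<ge> Suc N0" for N
    proof -
      have N: "1 \<le> N" using that by simp
      have "1 / d < real N" using N0 that by linarith
      then have Nd: "1 / real N < d" using d(1) N by (simp add: field_simps)
      have near: "cmod ((\<Sum>k=1..N. f (z k)) / real N - I) < r / 4"
        if z: "\<And>k. k \<in> {1..N} \<Longrightarrow> z k \<in> cell N k" for z
      proof -
        have l: "(real k - 1) / real N \<le> real k / real N" "real k / real N - (real k - 1) / real N = 1 / real N" for k
          by (simp_all add: diff_divide_distrib)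
        have "cmod ((\<Sum>(x, K)\<in>(\<lambda>k. (z k, cell N k)) ` {1..N}. measure lborel K *\<^sub>R f x) - I) < r / 4"
        proof (intro d(2) cell_tagged_division N z)
          fix x K assume "(x, K) \<in> (\<lambda>k. (z k, cell N k)) ` {1..N}"
          then obtain k where "K = cell N k" by auto
          then show "diameter K < d" using Nd l(2)[of k] d(1) by (simp add: cell_def)
        qed
        also have "(\<Sum>(x, K)\<in>(\<lambda>k. (z k, cell N k)) ` {1..N}. measure lborel K *\<^sub>R f x)
            = (\<Sum>k=1..N. measure lborel (cell N k) *\<^sub>R f (z k))"
          by (subst sum.reindex[OF cell_inj[OF N]]) simp
        also have "\<dots> = (\<Sum>k=1..N. f (z k)) / real N"
          unfolding sum_divide_distrib
        proof (rule sum.cong[OF refl])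
          fix k
          have "measure lborel (cell N k) = 1 / real N"
            unfolding cell_def using l by (subst measure_lborel_Icc) auto
          then show "measure lborel (cell N k) *\<^sub>R f (z k) = f (z k) / real N"
            by (simp add: scaleR_conv_of_real)
        qed
        finally show ?thesis .
      qed
      have half: "mean N (\<lambda>k. \<bar>p (f (real k / real N)) - p (f (y N k))\<bar>) < r / 2"
        if p: "linear p" "\<And>w. \<bar>p w\<bar> \<le> cmod w" for p :: "complex \<Rightarrow> real"
      proof -
        let ?a = "\<lambda>k. real k / real N"
        let ?P = "\<lambda>k. p (f (y N k)) \<le> p (f (?a k))"
        let ?z = "\<lambda>k. if ?P k then ?a k else y N k"
        let ?w = "\<lambda>k. if ?P k then y N k else ?a k"
        let ?S = "\<lambda>z. (\<Sum>k=1..N. f (z k)) / of_real (real N)"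
        have z: "cmod (?S ?z - I) < r / 4" and w: "cmod (?S ?w - I) < r / 4"
          by (rule near; use y right_end_in_cell in auto)+
        have "p (?S v) = (\<Sum>k=1..N. p (f (v k))) / real N" for v
          using linear_scale[OF p(1), of "1 / real N" "\<Sum>k=1..N. f (v k)"]
          by (simp add: linear_sum[OF p(1)] scaleR_conv_of_real)
        then have "p (?S ?z) - p (?S ?w) = (\<Sum>k=1..N. p (f (?z k)) - p (f (?w k))) / real N"
          by (simp only: diff_divide_distrib sum_subtractf)
        also have "(\<Sum>k=1..N. p (f (?z k)) - p (f (?w k))) = (\<Sum>k=1..N. \<bar>p (f (?a k)) - p (f (y N k))\<bar>)"
          by (rule sum.cong) auto
        finally have "mean N (\<lambda>k. \<bar>p (f (?a k)) - p (f (y N k))\<bar>) = p (?S ?z) - p (?S ?w)"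
          by (simp only: mean_def)
        also have "\<dots> = p (?S ?z - ?S ?w)" by (simp add: linear_diff[OF p(1)])
        also have "\<dots> \<le> cmod (?S ?z - ?S ?w)" using p(2) abs_le_D1 by blast
        also have "\<dots> \<le> cmod (?S ?z - I) + cmod (?S ?w - I)"
          using norm_triangle_ineq4[of "?S ?z - I" "?S ?w - I"] by simp
        finally show ?thesis using z w by linarith
      qed
      have "mean N (\<lambda>k. cmod (f (real k / real N) - f (y N k)))
        \<le> mean N (\<lambda>k. \<bar>Re (f (real k / real N)) - Re (f (y N k))\<bar> + \<bar>Im (f (real k / real N)) - Im (f (y N k))\<bar>)"
        by (intro mean_mono) (simp only: cmod_le flip: minus_complex.sel)
      also have "\<dots> < r / 2 + r / 2"
        unfolding mean_add
        by (intro add_strict_mono half bounded_linear.linear bounded_linear_Re bounded_linear_Im abs_Re_le_cmod abs_Im_le_cmod)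
      finally show ?thesis
        using mean_nonneg[of N "\<lambda>k. cmod (f (real k / real N) - f (y N k))"] by simp
    qed
    then show "\<exists>no. \<forall>N\<ge>no. norm (mean N (\<lambda>k. cmod (f (real k / real N) - f (y N k))) - 0) < r"
      by auto
  qed
qed

section \<open>Operations that preserve approximation in the mean\<close>

lemma mean_approx_grid: "mean_approx (\<lambda>N k. u (real k / real N)) u"
  by (simp add: mean_approx_def mean_def)

lemma mean_approx_cnj_grid_mult:
  assumes V: "mean_approx V u" and b: "bounded (f ` {0..1})"
  shows "mean_approx (\<lambda>N k. cnj (f (real k / real N)) * V N k) (\<lambda>t. cnj (f t) * u t)"
proof -
  obtain B where B: "0 \<le> B" "\<And>t. t \<in> {0..1} \<Longrightarrow> cmod (f t) \<le> B"
    using bounded_unitE[OF b] by blast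
  show ?thesis
    unfolding mean_approx_def
  proof (rule tendsto_zero_dominated)
    show "(\<lambda>N. B * mean N (\<lambda>k. cmod (V N k - u (real k / real N)))) \<longlonglongrightarrow> 0"
      using V unfolding mean_approx_def by (intro tendsto_mult_right_zero)
    fix N :: nat
    show "mean N (\<lambda>k. cmod (cnj (f (real k / real N)) * V N k - cnj (f (real k / real N)) * u (real k / real N)))
      \<le> B * mean N (\<lambda>k. cmod (V N k - u (real k / real N)))"
      unfolding mean_cmult[symmetric] right_diff_distrib[symmetric] norm_mult complex_mod_cnj
      by (intro mean_mono mult_right_mono B right_end_in_unit) auto
  qed (auto intro: mean_nonneg)
qed

text \<open>This is the effect of an annihilation on the next factor. The partial Riemann sums
  converge uniformly in \<open>k\<close>, hence are also bounded by \<open>\<delta> N + B\<close>;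
  such multipliers preserve convergence in the mean of the factor \<open>W\<close>.\<close>

lemma mean_approx_mult_primitive:
  assumes u: "riemann_regular u" "mean_approx V u" and v: "riemann_regular v" "mean_approx W v"
  shows "mean_approx (\<lambda>N k. W N k * ((\<Sum>j\<in>{1..<k}. V N j) / real N)) (\<lambda>t. v t * primitive u t)"
proof -
  obtain \<delta> where d: "\<delta> \<longlonglongrightarrow> 0"
    "\<And>N k. k \<in> {1..N} \<Longrightarrow> cmod ((\<Sum>j=1..k. V N j) / real N - primitive u (real k / real N)) \<le> \<delta> N"
    "\<And>N k. k \<in> {1..N} \<Longrightarrow> cmod ((\<Sum>j\<in>{1..<k}. V N j) / real N - primitive u (real k / real N)) \<le> \<delta> N"
    by (rule riemann_sum_uniform[OF u]) blast
  have b: "bounded (v ` {0..1})" "bounded (primitive u ` {0..1})"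
    using v(1) riemann_regular_primitive[OF u(1)] by (simp_all add: riemann_regular_def)
  obtain A where A: "0 \<le> A" "\<And>t. t \<in> {0..1} \<Longrightarrow> cmod (v t) \<le> A"
    using bounded_unitE[OF b(1)] by blast
  obtain B where B: "0 \<le> B" "\<And>t. t \<in> {0..1} \<Longrightarrow> cmod (primitive u t) \<le> B"
    using bounded_unitE[OF b(2)] by blast
  show ?thesis
    unfolding mean_approx_def
  proof (rule tendsto_zero_dominated)
    let ?m = "\<lambda>N. mean N (\<lambda>k. cmod (W N k - v (real k / real N)))"
    have "(\<lambda>N. (\<delta> N + B) * ?m N + A * \<delta> N) \<longlonglongrightarrow> (0 + B) * 0 + A * 0"
      by (intro tendsto_add tendsto_mult tendsto_const d(1) v(2)[unfolded mean_approx_def])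
    then show "(\<lambda>N. (\<delta> N + B) * ?m N + A * \<delta> N) \<longlonglongrightarrow> 0" by simp
    fix N :: nat assume N: "1 \<le> N"
    have "mean N (\<lambda>k. cmod (W N k * ((\<Sum>j\<in>{1..<k}. V N j) / real N) - v (real k / real N) * primitive u (real k / real N)))
      \<le> mean N (\<lambda>k. (\<delta> N + B) * cmod (W N k - v (real k / real N)) + A * \<delta> N)"
    proof (rule mean_mono)
      fix k assume k: "k \<in> {1..N}"
      have "cmod ((\<Sum>j\<in>{1..<k}. V N j) / real N) \<le> \<delta> N + B"
        using d(3)[OF k] B(2)[OF right_end_in_unit[OF k]]
          norm_triangle_ineq[of "(\<Sum>j\<in>{1..<k}. V N j) / real N - primitive u (real k / real N)" "primitive u (real k / real N)"]
        by simp
      then show "cmod (W N k * ((\<Sum>j\<in>{1..<k}. V N j) / real N) - v (real k / real N) * primitive u (real k / real N))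
        \<le> (\<delta> N + B) * cmod (W N k - v (real k / real N)) + A * \<delta> N"
        by (intro order_trans[OF cmod_mult_diff] add_mono mult_right_mono mult_mono d(3) k A right_end_in_unit) auto
    qed
    then show "mean N (\<lambda>k. cmod (W N k * ((\<Sum>j\<in>{1..<k}. V N j) / real N) - v (real k / real N) * primitive u (real k / real N)))
      \<le> (\<delta> N + B) * ?m N + A * \<delta> N"
      by (simp add: mean_add mean_cmult mean_const[OF N])
  qed (auto intro: mean_nonneg)
qed

text \<open>The case \<open>k = N\<close> of the uniform estimate. It yields the limit of the scalar
  that appears when the last remaining factor is annihilated.\<close>

lemma riemann_sum_limit:
  assumes u: "riemann_regular u" "mean_approx V u"
  shows "(\<lambda>N. (\<Sum>j=1..N. V N j) / real N) \<longlonglongrightarrow> (LINT s|lebesgue_on {0..1}. u s)"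
proof -
  obtain \<delta> where d: "\<delta> \<longlonglongrightarrow> 0"
    "\<And>N k. k \<in> {1..N} \<Longrightarrow> cmod ((\<Sum>j=1..k. V N j) / real N - primitive u (real k / real N)) \<le> \<delta> N"
    "\<And>N k. k \<in> {1..N} \<Longrightarrow> cmod ((\<Sum>j\<in>{1..<k}. V N j) / real N - primitive u (real k / real N)) \<le> \<delta> N"
    by (rule riemann_sum_uniform[OF u]) blast
  have "u \<in> borel_measurable (lebesgue_on {0..1})" "bounded (u ` {0..1})"
    using u by (auto simp: riemann_regular_def)
  then have P: "primitive u 1 = (LINT s|lebesgue_on {0..1}. u s)"
    by (simp add: primitive_eq_integral lebesgue_integral_unit)
  have "(\<lambda>N. cmod ((\<Sum>j=1..N. V N j) / real N - primitive u 1)) \<longlonglongrightarrow> 0"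
  proof (rule tendsto_zero_dominated[OF d(1)])
    fix N :: nat assume "1 \<le> N"
    then show "cmod ((\<Sum>j=1..N. V N j) / real N - primitive u 1) \<le> \<delta> N"
      using d(2)[of N N] by simp
  qed simp
  from LIM_zero_cancel[OF tendsto_norm_zero_cancel[OF this]] show ?thesis
    unfolding P .
qed

section \<open>Product vectors in the two Fock spaces\<close>

text \<open>A scaled elementary tensor at level \<open>length us\<close>. The restriction to
  increasing arguments is left to \<open>simplex_measure\<close>, so the rules below are equalities
  of functions and not only \<open>cont_eq\<close>. The scalar \<open>c\<close> collects the
  integrals over annihilated last factors.\<close>

definition cont_product :: "complex \<Rightarrow> (real \<Rightarrow> complex) list \<Rightarrow> cont_vec" where
  "cont_product c us = (\<lambda>n t. if n = length us then c * (\<Prod>i<n. (us ! i) (t i)) else 0)"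

text \<open>Each particle carries the factor \<open>1 / sqrt N\<close> of the creation operator that
  made it. Indices are confined to \<open>{1..N}\<close>, the range of the sum in
  \<open>disc_S\<close>.\<close>

definition disc_product :: "nat \<Rightarrow> complex \<Rightarrow> (nat \<Rightarrow> complex) list \<Rightarrow> disc_vec" where
  "disc_product N c Us = (\<lambda>\<beta>. if \<beta> \<in> incr_seqs \<and> set \<beta> \<subseteq> {1..N} \<and> length \<beta> = length Us
     then c * (\<Prod>i<length Us. (Us ! i) (\<beta> ! i)) * of_real (1 / sqrt (real N)) ^ length Us else 0)"

lemma cont_product_vacuum: "cont_product 1 [] = cont_vacuum"
  by (auto simp: cont_product_def cont_vacuum_def fun_eq_iff)

lemma cont_create_product: "cont_create f (cont_product c us) = cont_product c (f # us)"
proof (intro ext)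
  fix n t
  show "cont_create f (cont_product c us) n t = cont_product c (f # us) n t"
    by (cases n) (auto simp: cont_create_def cont_product_def prod.lessThan_Suc_shift simp del: prod.lessThan_Suc)
qed

text \<open>The removed argument is bounded only by the next one, so integrating it out alters only
  the factor \<open>v\<close>. If no argument remains there is no upper limit, and the full integral
  goes into the scalar. The zero vector is written \<open>cont_product 0 []\<close>.\<close>

lemma cont_annihilate_product:
  "cont_annihilate f (cont_product c []) = cont_product 0 []"
  "cont_annihilate f (cont_product c [u]) = cont_product (c * (LINT s|lebesgue_on {0..1}. cnj (f s) * u s)) []"
  "cont_annihilate f (cont_product c (u # v # us)) =
     cont_product c ((\<lambda>t. v t * primitive (\<lambda>s. cnj (f s) * u s) t) # us)"
proof -
  show "cont_annihilate f (cont_product c []) = cont_product 0 []"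
    by (simp add: cont_annihilate_def cont_product_def fun_eq_iff)
  show "cont_annihilate f (cont_product c [u]) = cont_product (c * (LINT s|lebesgue_on {0..1}. cnj (f s) * u s)) []"
  proof (intro ext)
    fix n t
    have "(LINT s|lebesgue_on {0..1}. cnj (f s) * (c * u s)) = c * (LINT s|lebesgue_on {0..1}. cnj (f s) * u s)"
      by (simp add: mult.left_commute)
    then show "cont_annihilate f (cont_product c [u]) n t =
        cont_product (c * (LINT s|lebesgue_on {0..1}. cnj (f s) * u s)) [] n t"
      by (auto simp: cont_annihilate_def cont_product_def set_lebesgue_integral_def)
  qed
  show "cont_annihilate f (cont_product c (u # v # us)) =
     cont_product c ((\<lambda>t. v t * primitive (\<lambda>s. cnj (f s) * u s) t) # us)"
  proof (intro ext)
    fix n t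
    let ?P = "\<Prod>i<length us. (us ! i) (t (Suc i))"
    show "cont_annihilate f (cont_product c (u # v # us)) n t =
       cont_product c ((\<lambda>t. v t * primitive (\<lambda>s. cnj (f s) * u s) t) # us) n t"
    proof (cases "n = Suc (length us)")
      case True
      have "cont_annihilate f (cont_product c (u # v # us)) n t =
          (LINT s|lebesgue_on {0..1}. (c * (v (t 0) * ?P)) * (indicator {s. s < t 0} s *\<^sub>R (cnj (f s) * u s)))"
        unfolding cont_annihilate_def set_lebesgue_integral_def True
        by (intro Bochner_Integration.integral_cong refl)
          (simp add: cont_product_def prod.lessThan_Suc_shift del: prod.lessThan_Suc)
      also have "\<dots> = c * (v (t 0) * ?P) * primitive (\<lambda>s. cnj (f s) * u s) (t 0)"
        unfolding primitive_def set_lebesgue_integral_def by (rule integral_mult_right_zero)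
      finally show ?thesis
        by (simp add: True cont_product_def prod.lessThan_Suc_shift mult_ac del: prod.lessThan_Suc)
    next
      case False
      then show ?thesis by (simp add: cont_annihilate_def cont_product_def)
    qed
  qed
qed

lemma disc_product_vacuum: "disc_product N 1 [] = disc_vacuum"
  by (auto simp: disc_product_def disc_vacuum_def disc_basis_def incr_seqs_def fun_eq_iff)

lemma disc_create_product:
  "disc_S 1 N f (disc_product N c Us) = disc_product N c ((\<lambda>k. f (real k / real N)) # Us)"
proof
  fix \<beta>
  show "disc_S 1 N f (disc_product N c Us) \<beta> = disc_product N c ((\<lambda>k. f (real k / real N)) # Us) \<beta>"
  proof (cases \<beta>)
    case Nil
    then show ?thesis by (simp add: disc_S_def disc_create_def disc_product_def)
  next
    case (Cons b \<gamma>)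
    \<comment> \<open>Only the creation operator whose index is the head \<open>b\<close>
      contributes at \<open>\<beta>\<close>; its ordering condition is the membership of
      \<open>\<beta>\<close> in \<open>incr_seqs\<close>.\<close>
    have "(\<Sum>k=1..N. f (real k / real N) * disc_create k (disc_product N c Us) \<beta>)
      = (\<Sum>k=1..N. if b = k then (if \<beta> \<in> incr_seqs then f (real b / real N) * disc_product N c Us \<gamma> else 0) else 0)"
      by (intro sum.cong refl) (simp add: Cons disc_create_def)
    also have "\<dots> = (if b \<in> {1..N} \<and> \<beta> \<in> incr_seqs then f (real b / real N) * disc_product N c Us \<gamma> else 0)"
      by (simp add: sum.delta')
    finally have "disc_S 1 N f (disc_product N c Us) \<beta> = of_real (1 / sqrt (real N)) *
      (if b \<in> {1..N} \<and> \<beta> \<in> incr_seqs then f (real b / real N) * disc_product N c Us \<gamma> else 0)"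
      by (simp add: disc_S_def)
    moreover have "\<beta> \<in> incr_seqs \<Longrightarrow> \<gamma> \<in> incr_seqs" using tl_incr[of \<beta>] Cons by simp
    ultimately show ?thesis
      by (auto simp: Cons disc_product_def prod.lessThan_Suc_shift simp del: prod.lessThan_Suc)
  qed
qed

lemma disc_annihilate_S:
  "disc_S (- 1) N f x \<beta> = of_real (1 / sqrt (real N)) *
     (\<Sum>k\<in>{k\<in>{1..N}. k # \<beta> \<in> incr_seqs}. cnj (f (real k / real N)) * x (k # \<beta>))"
proof -
  have "(\<Sum>k=1..N. cnj (f (real k / real N)) * disc_annihilate k x \<beta>) =
    (\<Sum>k\<in>{k\<in>{1..N}. k # \<beta> \<in> incr_seqs}. cnj (f (real k / real N)) * x (k # \<beta>))"
    by (rule sum.mono_neutral_cong_right) (auto simp: disc_annihilate_def)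
  then show ?thesis by (simp add: disc_S_def)
qed

text \<open>The factor of the annihilation operator and that of the removed particle combine to the
  weight of a Riemann sum. At \<open>N = 0\<close> both sides are 0.\<close>

lemma inverse_sqrt_square: "of_real (1 / sqrt (real N)) * of_real (1 / sqrt (real N)) = (1 / real N :: complex)"
  by (simp flip: of_real_mult)

lemma disc_annihilate_product:
  "disc_S (- 1) N f (disc_product N c []) = disc_product N 0 []"
  "disc_S (- 1) N f (disc_product N c [U]) =
     disc_product N (c * ((\<Sum>k=1..N. cnj (f (real k / real N)) * U k) / real N)) []"
  "disc_S (- 1) N f (disc_product N c (U # V # Us)) =
     disc_product N c ((\<lambda>k. V k * ((\<Sum>j\<in>{1..<k}. cnj (f (real j / real N)) * U j) / real N)) # Us)"
proof -
  let ?r = "of_real (1 / sqrt (real N)) :: complex"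
  show "disc_S (- 1) N f (disc_product N c []) = disc_product N 0 []"
    by (rule ext) (simp add: disc_annihilate_S disc_product_def)
  show "disc_S (- 1) N f (disc_product N c [U]) =
     disc_product N (c * ((\<Sum>k=1..N. cnj (f (real k / real N)) * U k) / real N)) []"
  proof
    fix \<beta>
    show "disc_S (- 1) N f (disc_product N c [U]) \<beta> =
     disc_product N (c * ((\<Sum>k=1..N. cnj (f (real k / real N)) * U k) / real N)) [] \<beta>"
    proof (cases "\<beta> = []")
      case True
      have "(\<Sum>k\<in>{k\<in>{1..N}. k # \<beta> \<in> incr_seqs}. cnj (f (real k / real N)) * disc_product N c [U] (k # \<beta>))
        = (\<Sum>k=1..N. (c * ?r) * (cnj (f (real k / real N)) * U k))"
        by (rule sum.cong) (auto simp: True incr_seqs_def disc_product_def)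
      then have "disc_S (- 1) N f (disc_product N c [U]) \<beta>
        = (?r * ?r) * (c * (\<Sum>k=1..N. cnj (f (real k / real N)) * U k))"
        unfolding disc_annihilate_S sum_distrib_left[symmetric] by (simp only: mult_ac)
      then show ?thesis
        unfolding inverse_sqrt_square by (simp add: True disc_product_def incr_seqs_def)
    next
      case False
      then show ?thesis by (simp add: disc_annihilate_S disc_product_def)
    qed
  qed
  let ?W = "\<lambda>k. V k * ((\<Sum>j\<in>{1..<k}. cnj (f (real j / real N)) * U j) / real N)"
  show "disc_S (- 1) N f (disc_product N c (U # V # Us)) = disc_product N c (?W # Us)"
  proof
    fix \<beta>
    show "disc_S (- 1) N f (disc_product N c (U # V # Us)) \<beta> = disc_product N c (?W # Us) \<beta>"
    proof (cases "\<beta> \<in> incr_seqs \<and> set \<beta> \<subseteq> {1..N} \<and> length \<beta> = Suc (length Us)")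
      case True
      then obtain b \<gamma> where b: "\<beta> = b # \<gamma>" by (cases \<beta>) auto
      let ?P = "\<Prod>i<length Us. (Us ! i) (\<gamma> ! i)"
      \<comment> \<open>Comparison with the head suffices, since \<open>\<beta>\<close> is
        increasing. As \<open>b \<le> N\<close>, the admissible indices are exactly
        \<open>{1..<b}\<close>, the discrete counterpart of \<open>s < t 0\<close>.\<close>
      have inc: "k # \<beta> \<in> incr_seqs \<longleftrightarrow> k < b" for k
        using True by (auto simp: incr_seqs_def b)
      have "(\<Sum>k\<in>{k\<in>{1..N}. k # \<beta> \<in> incr_seqs}. cnj (f (real k / real N)) * disc_product N c (U # V # Us) (k # \<beta>))
        = (\<Sum>k\<in>{1..<b}. (c * V b * ?P * ?r ^ length Us * ?r * ?r) * (cnj (f (real k / real N)) * U k))"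
        using True by (intro sum.cong)
          (auto simp: inc[unfolded b] disc_product_def b prod.lessThan_Suc_shift power_Suc2 mult_ac simp del: prod.lessThan_Suc power_Suc)
      \<comment> \<open>Of the \<open>length Us + 3\<close> factors \<open>?r\<close>, two become
        the weight \<open>1 / N\<close>; the others normalise the product with one factor
        less.\<close>
      then have "disc_S (- 1) N f (disc_product N c (U # V # Us)) \<beta> =
        (?r * ?r) * (c * V b * ?P * ?r ^ length Us * ?r * (\<Sum>k\<in>{1..<b}. cnj (f (real k / real N)) * U k))"
        unfolding disc_annihilate_S sum_distrib_left[symmetric] by (simp only: mult_ac)
      then show ?thesis
        using True unfolding inverse_sqrt_square
        by (simp add: disc_product_def b prod.lessThan_Suc_shift mult_ac del: prod.lessThan_Suc)
    next
      case False
      moreover have "k # \<beta> \<in> incr_seqs \<Longrightarrow> \<beta> \<in> incr_seqs" for k using tl_incr[of "k # \<beta>"] by simp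
      ultimately have "k # \<beta> \<in> incr_seqs \<Longrightarrow> disc_product N c (U # V # Us) (k # \<beta>) = 0" for k
        by (auto simp: disc_product_def)
      then have "disc_S (- 1) N f (disc_product N c (U # V # Us)) \<beta> = 0"
        by (simp add: disc_annihilate_S)
      with False show ?thesis by (auto simp: disc_product_def)
    qed
  qed
qed

lemma disc_inner_vacuum_product: "disc_inner disc_vacuum (disc_product N c Us) = (if Us = [] then c else 0)"
proof -
  have "disc_inner disc_vacuum (disc_product N c Us) = (\<Sum>\<^sub>\<infinity>\<alpha>\<in>{[]}. disc_product N c Us \<alpha>)"
    unfolding disc_inner_def
    by (rule infsum_cong_neutral) (auto simp: disc_vacuum_def disc_basis_def incr_seqs_def)
  then show ?thesis by (simp add: disc_product_def incr_seqs_def)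
qed

text \<open>Level 0 is a point of mass 1, so the vacuum has norm 1 and the state reads off the
  scalar \<open>c\<close>.\<close>

lemma measure_simplex_0: "measure (simplex_measure 0) (space (simplex_measure 0)) = 1"
proof -
  have "incr_simplex 0 = {\<lambda>_. undefined}" by (auto simp: incr_simplex_def)
  then show ?thesis
    by (simp add: space_simplex_measure simplex_measure_def measure_restrict_space PiM_empty
        measure_def emeasure_restrict_space)
qed

lemma cont_inner_vacuum_product: "cont_inner cont_vacuum (cont_product c us) = (if us = [] then c else 0)"
proof -
  have "cont_inner cont_vacuum (cont_product c us) =
    (\<Sum>n\<in>{0}. LINT t|simplex_measure n. cnj (cont_vacuum n t) * cont_product c us n t)"
    unfolding cont_inner_def by (rule suminf_finite) (auto simp: cont_vacuum_def)
  also have "\<dots> = (if us = [] then c else 0)"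
    using measure_simplex_0 by (simp add: cont_vacuum_def cont_product_def scaleR_conv_of_real)
  finally show ?thesis .
qed


section \<open>Induction on the word and the limit of the vacuum states\<close>

lemma op_prod_Cons: "op_prod (X # Xs) v = X (op_prod Xs v)"
  by (simp add: op_prod_def)

lemma cont_op_sign: "cont_op 1 = cont_create" "cont_op (- 1) = cont_annihilate"
  by (simp_all add: cont_op_def fun_eq_iff)

definition approximates :: "(nat \<Rightarrow> nat \<Rightarrow> complex) \<Rightarrow> (real \<Rightarrow> complex) \<Rightarrow> bool" where
  "approximates V u \<longleftrightarrow> riemann_regular u \<and> mean_approx V u"

text \<open>Words that annihilate the vacuum are covered by \<open>c = 0\<close>; their product form has no particles
  whatever the parity of the word, hence the disjunction in the last conjunct.\<close>

lemma word_vacuum_product: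
  fixes \<epsilon> :: "nat \<Rightarrow> int" and f :: "nat \<Rightarrow> real \<Rightarrow> complex"
  assumes "\<And>j. j \<in> set js \<Longrightarrow> \<epsilon> j \<in> {-1, 1}" "\<And>j. j \<in> set js \<Longrightarrow> f j \<in> Rinf"
  shows "\<exists>c us C Vs. C \<longlonglongrightarrow> c \<and> list_all2 approximates Vs us \<and>
    op_prod (map (\<lambda>j. cont_op (\<epsilon> j) (f j)) js) cont_vacuum = cont_product c us \<and>
    (\<forall>N. op_prod (map (\<lambda>j. disc_S (\<epsilon> j) N (f j)) js) disc_vacuum
           = disc_product N (C N) (map (\<lambda>V. V N) Vs)) \<and>
    (c = 0 \<or> even (length us + length js))"
  using assms
proof (induction js)
  case Nil
  show ?case
    by (rule exI[of _ 1], rule exI[of _ "[]"], rule exI[of _ "\<lambda>_. 1"], rule exI[of _ "[]"])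
      (simp add: cont_product_vacuum disc_product_vacuum op_prod_def)
next
  case (Cons j js)
  have "f j \<in> Rinf" using Cons.prems(2) by simp
  then have f: "riemann_regular (f j)" by (rule Rinf_riemann_regular)
  then have fb: "bounded (f j ` {0..1})" by (simp add: riemann_regular_def)
  obtain c us C Vs where IH: "C \<longlonglongrightarrow> c" "list_all2 approximates Vs us"
    "op_prod (map (\<lambda>j. cont_op (\<epsilon> j) (f j)) js) cont_vacuum = cont_product c us"
    "\<And>N. op_prod (map (\<lambda>j. disc_S (\<epsilon> j) N (f j)) js) disc_vacuum
           = disc_product N (C N) (map (\<lambda>V. V N) Vs)"
    "c = 0 \<or> even (length us + length js)"
    using Cons by auto
  note step_simps = op_prod_Cons IH(3,4) cont_op_sign cont_create_product disc_create_product
    cont_annihilate_product disc_annihilate_product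
  consider "\<epsilon> j = 1" | "\<epsilon> j = -1" using Cons.prems(1)[of j] by auto
  then show ?case
  proof cases
    case 1
    let ?F = "\<lambda>N k. f j (real k / real N)"
    have "approximates ?F (f j)" using f mean_approx_grid by (simp add: approximates_def)
    \<comment> \<open>A creation lengthens both the word and the factor list by one, so the parity
      of the sum of the lengths is kept.\<close>
    with IH show ?thesis
      by (intro exI[of _ c] exI[of _ "f j # us"] exI[of _ C] exI[of _ "?F # Vs"])
        (auto simp: step_simps 1)
  next
    case 2
    have step: "riemann_regular (\<lambda>s. cnj (f j s) * u s)"
      "mean_approx (\<lambda>N k. cnj (f j (real k / real N)) * V N k) (\<lambda>s. cnj (f j s) * u s)"
      if "approximates V u" for V u
      using that by (auto simp: approximates_def intro!: riemann_regular_mult riemann_regular_cnj f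
          mean_approx_cnj_grid_mult fb)
    consider "us = []" "Vs = []"
      | u V where "us = [u]" "Vs = [V]" "approximates V u"
      | u v us' V W Vs' where "us = u # v # us'" "Vs = V # W # Vs'" "approximates V u"
        "approximates W v" "list_all2 approximates Vs' us'"
      using IH(2) by (cases us; cases "tl us") (auto simp: list_all2_Cons2)
    then show ?thesis
    proof cases
      case A: 1
      show ?thesis
        by (intro exI[of _ 0] exI[of _ "[]"] exI[of _ "\<lambda>_. 0"])
          (simp add: step_simps A 2)
    next
      case A: 2
      let ?C = "\<lambda>N. C N * ((\<Sum>k=1..N. cnj (f j (real k / real N)) * V N k) / real N)"
      let ?c = "c * (LINT s|lebesgue_on {0..1}. cnj (f j s) * u s)"
      have "?C \<longlonglongrightarrow> ?c"
        by (intro tendsto_mult IH(1) riemann_sum_limit[OF step[OF A(3)]])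
      \<comment> \<open>The word grows by one letter while one factor disappears, which leaves the
        sum of the lengths unchanged.\<close>
      with IH(5) show ?thesis
        by (intro exI[of _ ?c] exI[of _ "[]"] exI[of _ ?C])
          (auto simp: step_simps A(1,2) 2)
    next
      case A: 3
      let ?W = "\<lambda>N k. W N k * ((\<Sum>i\<in>{1..<k}. cnj (f j (real i / real N)) * V N i) / real N)"
      let ?w = "\<lambda>t. v t * primitive (\<lambda>s. cnj (f j s) * u s) t"
      have "approximates ?W ?w"
        using A(4) unfolding approximates_def
        by (blast intro: riemann_regular_mult[OF _ riemann_regular_primitive[OF step(1)[OF A(3)]]]
            mean_approx_mult_primitive[OF step[OF A(3)]])
      with IH(1,5) A(5) show ?thesis
        by (intro exI[of _ c] exI[of _ "?w # us'"] exI[of _ C] exI[of _ "?W # Vs'"])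
          (auto simp: step_simps A(1,2) 2)
    qed
  qed
qed



theorem theorem3p7:
  fixes m :: nat and \<epsilon> :: "nat \<Rightarrow> int" and f :: "nat \<Rightarrow> real \<Rightarrow> complex"
  assumes "m \<ge> 1"
    and "\<And>j. j \<in> {1..m} \<Longrightarrow> \<epsilon> j \<in> {-1, 1}"
    and "\<And>j. j \<in> {1..m} \<Longrightarrow> f j \<in> Rinf"
  shows "\<exists>L. (\<lambda>N. disc_state (op_prod (map (\<lambda>j. disc_S (\<epsilon> j) N (f j)) [1..<Suc m])))
               \<longlonglongrightarrow> L \<and>
             (odd m \<longrightarrow> L = 0) \<and>
             (\<forall>n. m = 2 * n \<longrightarrow>
               L = cont_state (op_prod (map (\<lambda>j. cont_op (\<epsilon> j) (f j)) [1..<Suc (2 * n)])))"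
proof -
  have "\<And>j. j \<in> set [1..<Suc m] \<Longrightarrow> \<epsilon> j \<in> {-1, 1}" "\<And>j. j \<in> set [1..<Suc m] \<Longrightarrow> f j \<in> Rinf"
    using assms(2,3) by (simp_all only: set_upt atLeastLessThanSuc_atLeastAtMost)
  from word_vacuum_product[of "[1..<Suc m]" \<epsilon> f, OF this]
  obtain c us C Vs where w: "C \<longlonglongrightarrow> c" "list_all2 approximates Vs us"
    "op_prod (map (\<lambda>j. cont_op (\<epsilon> j) (f j)) [1..<Suc m]) cont_vacuum = cont_product c us"
    "\<And>N. op_prod (map (\<lambda>j. disc_S (\<epsilon> j) N (f j)) [1..<Suc m]) disc_vacuum
           = disc_product N (C N) (map (\<lambda>V. V N) Vs)"
    "c = 0 \<or> even (length us + m)"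
    by (auto simp del: upt_Suc)
  \<comment> \<open>Both product forms have the same number of particles, so the two vacuum states
    are nonzero only in the same case, when no factor is left.\<close>
  have "Vs = [] \<longleftrightarrow> us = []" using list_all2_lengthD[OF w(2)] by auto
  then have disc: "disc_state (op_prod (map (\<lambda>j. disc_S (\<epsilon> j) N (f j)) [1..<Suc m]))
      = (if us = [] then C N else 0)" for N
    unfolding disc_state_def w(4) disc_inner_vacuum_product by simp
  have cont: "cont_state (op_prod (map (\<lambda>j. cont_op (\<epsilon> j) (f j)) [1..<Suc m]))
      = (if us = [] then c else 0)"
    unfolding cont_state_def w(3) cont_inner_vacuum_product by simp
  show ?thesis
  proof (intro exI[of _ "if us = [] then c else 0"] conjI impI allI)
    show "(\<lambda>N. disc_state (op_prod (map (\<lambda>j. disc_S (\<epsilon> j) N (f j)) [1..<Suc m])))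
        \<longlonglongrightarrow> (if us = [] then c else 0)"
      unfolding disc using w(1) by simp
    \<comment> \<open>With no factor left, the parity alternative says that \<open>c = 0\<close> or
      \<open>m\<close> is even.\<close>
    assume "odd m"
    with w(5) show "(if us = [] then c else 0) = 0" by auto
  next
    fix n assume "m = 2 * n"
    with cont show "(if us = [] then c else 0)
        = cont_state (op_prod (map (\<lambda>j. cont_op (\<epsilon> j) (f j)) [1..<Suc (2 * n)]))"
      by simp
  qed
qed

end
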